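(* Consider on $\mathbb{R}^3$ the singular Nambu-Poisson structure of order $3$ $$\Lambda=(x_1^2+x_2^2+x_3^2)\frac{\partial}{\partial x_1}\wedge\frac{\partial}{\partial x_2}\wedge\frac{\partial}{\partial x_3},$$ let $\mathcal{D}$ be its characteristic foliation, and let $\nu=dx_1\wedge dx_2\wedge dx_3$. (i) The homomorphisms $\#_r:\Omega^r(\mathbb{R}^3)\to\mathcal{V}^{3-r}(\mathbb{R}^3)$, $r=1,2,3$, induced by $\Lambda$ are monomorphisms. Therefore the foliated cohomology of $(\mathbb{R}^3,\mathcal{D})$ is isomorphic to the de Rham cohomology of $\mathbb{R}^3$. In particular, $H^1_{NP}(\mathbb{R}^3)\not\cong H^1(\mathcal{D})=\{0\}$. Consequently, the Nambu-Poisson cohomology and the foliated cohomology are not isomorphic. (ii) $\mathcal{M}_\Lambda^\nu\notin\#_1(\Omega^1(\mathbb{R}^3))$. Thus $\#_*(\Omega^*(\mathbb{R}^3))=\bigoplus_{k=0,\dots,3}\#_k(\Omega^k(\mathbb{R}^3))$ is not a subcomplex of the homology complex $(\mathcal{V}^*(\mathbb{R}^3),\delta_\nu)$.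
   Context: $(x_1,x_2,x_3)$ are the usual coordinates on $M=\mathbb{R}^3$, $\Omega^k(M)$ the $k$-forms, $\mathcal{V}^k(M)$ the $k$-vector fields. $\#_k:\Omega^k(M)\to\mathcal{V}^{3-k}(M)$ is $\#_k(\beta)=i(\beta)\Lambda$, with contraction in the first slots: $i(\alpha_1\wedge\dots\wedge\alpha_k)P=P(\alpha_1,\dots,\alpha_k,\cdot,\dots)$. $\Lambda$ is a Nambu-Poisson structure of order $3$: the bracket $\{f_1,f_2,f_3\}=\Lambda(df_1,df_2,df_3)$ satisfies $\{f_1,f_2,\{g_1,g_2,g_3\}\}=\{\{f_1,f_2,g_1\},g_2,g_3\}+\{g_1,\{f_1,f_2,g_2\},g_3\}+\{g_1,g_2,\{f_1,f_2,g_3\}\}$; it is singular because $\Lambda$ vanishes at the origin. The characteristic foliation $\mathcal{D}$ is the generalized foliation $\mathcal{D}(x)=\{i(\beta)\Lambda(x):\beta\in\Lambda^2(T_x^*M)\}$. Foliated cohomology $H^*(\mathcal{D})$. $\Omega^k(M,\mathcal{D})$ is the space of $\alpha\in\Omega^k(M)$ with $\alpha(X_1,\dots,X_k)=0$ for all $X_i\in\#_2(\Omega^2(M))$; $\Omega^k(\mathcal{D})=\Omega^k(M)/\Omega^k(M,\mathcal{D})$; $\tilde d[\alpha]=[d\alpha]$; $H^*(\mathcal{D})$ is the cohomology of $(\Omega^*(\mathcal{D}),\tilde d)$. Nambu-Poisson cohomology $H^*_{NP}(M)$. Let $[\![\alpha,\beta]\!]=\mathcal{L}_{\#_2(\alpha)}\beta-\#_3(d\alpha)\beta$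 on $\Omega^2(M)$, where $\mathcal{L}$ is the Lie derivative; it induces a Lie bracket on $\Omega^2(M)/\ker\#_2$. The $k$-cochains are the skew-symmetric $C^\infty(M,\mathbb{R})$-multilinear maps $c^k:(\Omega^2(M)/\ker\#_2)^k\to C^\infty(M,\mathbb{R})$ (functions for $k=0$), with $$\tilde\partial c^k([\alpha_0],\dots,[\alpha_k])=\sum_{i=0}^k(-1)^i\#_2(\alpha_i)\big(c^k([\alpha_0],\dots,\widehat{[\alpha_i]},\dots,[\alpha_k])\big)+\sum_{0\le i<j\le k}(-1)^{i-1}c^k([\alpha_0],\dots,\widehat{[\alpha_i]},\dots,[\alpha_{j-1}],[[\![\alpha_i,\alpha_j]\!]],[\alpha_{j+1}],\dots,[\alpha_k]).$$ $H^*_{NP}(M)$ is the cohomology of this complex. The bivector $\mathcal{M}_\Lambda^\nu$. For a vector field $X$, $\mathrm{div}_\nu X$ is the function with $\mathcal{L}_X\nu=(\mathrm{div}_\nu X)\nu$. For functions $f_1,f_2$ the Hamiltonian vector field is $X_{f_1f_2}=\#_2(df_1\wedge df_2)$. $\mathcal{M}_\Lambda^\nu\in\mathcal{V}^2(M)$ is the $2$-vector determined by $\mathcal{M}_\Lambda^\nu(df_1,df_2)=\mathrm{div}_\nu(X_{f_1f_2})$. The homology complex $(\mathcal{V}^*(M),\delta_\nu)$. Let $\flat_\nu:\mathcal{V}^k(M)\to\Omega^{3-k}(M)$ be the isomorphism $\flat_\nu(P)=i(P)\nu$ (contraction in the first slots). Then $\delta_\nu=\flat_\nu^{-1}\circ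 d\circ\flat_\nu:\mathcal{V}^k(M)\to\mathcal{V}^{k-1}(M)$, with $d$ the exterior differential. *)

theory Defs
  imports "HOL-Analysis.Analysis" "HOL-Combinatorics.Permutations" "HOL-Algebra.AbelCoset"
    "HOL-Algebra.Module"
begin

section \<open>Smooth functions, forms and multivector fields on three-space\<close>

type_synonym pt = "real^3"
type_synonym covec = "pt \<Rightarrow>\<^sub>L real"

text \<open>
  An element of the k-th exterior power of the dual of \<open>V\<close> is an alternating \<open>k\<close>-linear function on
  lists over \<open>V\<close> of length \<open>k\<close>, extended by \<open>0\<close> to lists of other lengths.  A \<open>k\<close>-vector is such a
  function on covectors.
\<close>
type_synonym form = "pt \<Rightarrow> pt list \<Rightarrow> real"
type_synonym mvfield = "pt \<Rightarrow> covec list \<Rightarrow> real"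

primrec Ck :: "nat \<Rightarrow> (pt \<Rightarrow> real) \<Rightarrow> bool" where
  "Ck 0 f \<longleftrightarrow> continuous_on UNIV f"
| "Ck (Suc k) f \<longleftrightarrow> (\<forall>x. f differentiable (at x)) \<and> (\<forall>v. Ck k (\<lambda>x. frechet_derivative f (at x) v))"

definition smooth :: "(pt \<Rightarrow> real) \<Rightarrow> bool" where
  "smooth f \<longleftrightarrow> (\<forall>k. Ck k f)"

definition alt_multilinear :: "nat \<Rightarrow> ('v::real_vector list \<Rightarrow> real) \<Rightarrow> bool" where
  "alt_multilinear k w \<longleftrightarrow>
     (\<forall>vs. length vs \<noteq> k \<longrightarrow> w vs = 0) \<and>
     (\<forall>vs i. length vs = k \<longrightarrow> i < k \<longrightarrow> linear (\<lambda>v. w (vs[i := v]))) \<and>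
     (\<forall>vs i j. length vs = k \<longrightarrow> i < j \<longrightarrow> j < k \<longrightarrow> vs ! i = vs ! j \<longrightarrow> w vs = 0)"

text \<open>At \<open>'v = pt\<close> this is the set of \<open>k\<close>-forms, at \<open>'v = covec\<close> the set of \<open>k\<close>-vector fields.\<close>
definition fields :: "nat \<Rightarrow> (pt \<Rightarrow> 'v::real_vector list \<Rightarrow> real) set" where
  "fields k = {w. (\<forall>x. alt_multilinear k (w x)) \<and> (\<forall>vs. smooth (\<lambda>x. w x vs))}"

text \<open>As modules over the smooth functions; the ring components are unused.\<close>
definition field_module :: "nat \<Rightarrow> (pt \<Rightarrow> real, pt \<Rightarrow> 'v::real_vector list \<Rightarrow> real) module" where
  "field_module k =
     \<lparr>carrier = fields k, mult = undefined, one = undefined, zero = (\<lambda>x vs. 0),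
      add = (\<lambda>a b x vs. a x vs + b x vs), smult = (\<lambda>f a x vs. f x * a x vs)\<rparr>"

abbreviation Omega :: "nat \<Rightarrow> (pt \<Rightarrow> real, form) module" where
  "Omega \<equiv> field_module"

abbreviation Mvf :: "nat \<Rightarrow> (pt \<Rightarrow> real, mvfield) module" where
  "Mvf \<equiv> field_module"

section \<open>Exterior calculus\<close>

definition remove_nth :: "nat \<Rightarrow> 'a list \<Rightarrow> 'a list" where
  "remove_nth i xs = take i xs @ drop (Suc i) xs"

definition wedge :: "('v \<Rightarrow> real) list \<Rightarrow> 'v list \<Rightarrow> real" where
  "wedge fs vs =
     (if length vs = length fs
      then \<Sum>p | p permutes {..<length fs}. of_int (sign p) * (\<Prod>i<length fs. (fs ! i) (vs ! p i))
      else 0)"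

definition pd :: "3 \<Rightarrow> pt" where
  "pd i = axis i 1"

definition dx :: "3 \<Rightarrow> covec" where
  "dx i = Blinfun (\<lambda>v. v $ i)"

definition diff :: "(pt \<Rightarrow> real) \<Rightarrow> pt \<Rightarrow> covec" where
  "diff f x = Blinfun (frechet_derivative f (at x))"

definition ext_deriv :: "form \<Rightarrow> form" where
  "ext_deriv w x vs =
     (\<Sum>i<length vs. (-1) ^ i * frechet_derivative (\<lambda>y. w y (remove_nth i vs)) (at x) (vs ! i))"

text \<open>
  The interior product \<open>i(b) P\<close>, for dual bases \<open>e\<close>, \<open>e'\<close> and \<open>b\<close> of degree \<open>k\<close>: the linear extension
  in \<open>b\<close> of \<open>i(a\<^sub>1 \<and> \<dots> \<and> a\<^sub>k) P = P(a\<^sub>1, \<dots>, a\<^sub>k, \<cdot>, \<dots>)\<close>, where \<open>b\<close> is expanded as the sum over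
  \<open>i\<^sub>1 < \<dots> < i\<^sub>k\<close> of \<open>b(e i\<^sub>1, \<dots>, e i\<^sub>k) e' i\<^sub>1 \<and> \<dots> \<and> e' i\<^sub>k\<close>.  In the index type \<open>3\<close> the numeral
  \<open>3\<close> equals \<open>0\<close>, so its order is \<open>3 < 1 < 2\<close>; the sum does not depend on the order chosen, because
  each summand is symmetric in \<open>i\<^sub>1, \<dots>, i\<^sub>k\<close>.
\<close>
definition contract ::
  "(3 \<Rightarrow> 'v) \<Rightarrow> (3 \<Rightarrow> 'w) \<Rightarrow> nat \<Rightarrow> ('v list \<Rightarrow> real) \<Rightarrow> ('w list \<Rightarrow> real) \<Rightarrow> 'w list \<Rightarrow> real" where
  "contract e e' k b P ws =
     (\<Sum>is | length is = k \<and> sorted_wrt (<) is. b (map e is) * P (map e' is @ ws))"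

definition vec_of :: "mvfield \<Rightarrow> pt \<Rightarrow> pt" where
  "vec_of P x = (\<chi> i. P x [dx i])"

text \<open>
  \<open>(L\<^sub>X w)(v\<^sub>1, \<dots>, v\<^sub>k) = X(w(v\<^sub>1, \<dots>, v\<^sub>k)) - \<Sum> w(\<dots>, [X, v\<^sub>i], \<dots>)\<close> for constant fields \<open>v\<^sub>i\<close>,
  for which \<open>[X, v\<^sub>i]\<close> is minus the derivative of \<open>X\<close> along \<open>v\<^sub>i\<close>.
\<close>
definition lie_deriv :: "(pt \<Rightarrow> pt) \<Rightarrow> form \<Rightarrow> form" where
  "lie_deriv X w x vs =
     frechet_derivative (\<lambda>y. w y vs) (at x) (X x) +
     (\<Sum>i<length vs. w x (vs[i := frechet_derivative X (at x) (vs ! i)]))"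

definition div_vol :: "form \<Rightarrow> (pt \<Rightarrow> pt) \<Rightarrow> pt \<Rightarrow> real" where
  "div_vol nu X = (THE f. \<forall>x vs. lie_deriv X nu x vs = f x * nu x vs)"

section \<open>Modules and cohomology\<close>

definition quot_module :: "('s, 'b) module \<Rightarrow> 'b set \<Rightarrow> ('s, 'b set) module" where
  "quot_module V N =
     \<lparr>carrier = a_rcosets\<^bsub>V\<^esub> N, mult = undefined, one = undefined, zero = N, add = set_add V,
      smult = (\<lambda>a X. \<Union>x\<in>X. N +>\<^bsub>V\<^esub> (a \<odot>\<^bsub>V\<^esub> x))\<rparr>"

definition real_scalars :: "(pt \<Rightarrow> real, 'b) module \<Rightarrow> (real, 'b) module" where
  "real_scalars V =
     \<lparr>carrier = carrier V, mult = undefined, one = undefined, zero = zero V, add = add V,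
      smult = (\<lambda>a. smult V (\<lambda>_. a))\<rparr>"

text \<open>Homomorphisms with respect to the scalars in \<open>S\<close>.\<close>
definition mod_hom :: "'s set \<Rightarrow> ('s, 'b) module \<Rightarrow> ('s, 'c) module \<Rightarrow> ('b \<Rightarrow> 'c) set" where
  "mod_hom S V W =
     {h. h \<in> carrier V \<rightarrow> carrier W \<and>
         (\<forall>x\<in>carrier V. \<forall>y\<in>carrier V. h (x \<oplus>\<^bsub>V\<^esub> y) = h x \<oplus>\<^bsub>W\<^esub> h y) \<and>
         (\<forall>a\<in>S. \<forall>x\<in>carrier V. h (a \<odot>\<^bsub>V\<^esub> x) = a \<odot>\<^bsub>W\<^esub> h x)}"

definition mod_mono :: "'s set \<Rightarrow> ('s, 'b) module \<Rightarrow> ('s, 'c) module \<Rightarrow> ('b \<Rightarrow> 'c) set" where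
  "mod_mono S V W = {h \<in> mod_hom S V W. inj_on h (carrier V)}"

definition vs_isomorphic :: "(real, 'b) module \<Rightarrow> (real, 'c) module \<Rightarrow> bool" where
  "vs_isomorphic V W \<longleftrightarrow> (\<exists>h \<in> mod_hom UNIV V W. bij_betw h (carrier V) (carrier W))"

definition cohomology ::
  "(nat \<Rightarrow> (pt \<Rightarrow> real, 'b) module) \<Rightarrow> (nat \<Rightarrow> 'b \<Rightarrow> 'b) \<Rightarrow> nat \<Rightarrow> (real, 'b set) module" where
  "cohomology C d k =
     quot_module
       ((real_scalars (C k))\<lparr>carrier := {z \<in> carrier (C k). d k z = \<zero>\<^bsub>C (Suc k)\<^esub>}\<rparr>)
       (case k of 0 \<Rightarrow> {\<zero>\<^bsub>C 0\<^esub>} | Suc j \<Rightarrow> d j ` carrier (C j))"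

definition deRham :: "nat \<Rightarrow> (real, form set) module" where
  "deRham = cohomology Omega (\<lambda>k. ext_deriv)"

section \<open>Nambu-Poisson structures of order 3\<close>

definition nambu_bracket ::
  "mvfield \<Rightarrow> (pt \<Rightarrow> real) \<Rightarrow> (pt \<Rightarrow> real) \<Rightarrow> (pt \<Rightarrow> real) \<Rightarrow> pt \<Rightarrow> real" where
  "nambu_bracket L f g h x = L x [diff f x, diff g x, diff h x]"

definition nambu_poisson :: "mvfield \<Rightarrow> bool" where
  "nambu_poisson L \<longleftrightarrow>
     L \<in> fields 3 \<and>
     (\<forall>f1 f2 g1 g2 g3. smooth f1 \<longrightarrow> smooth f2 \<longrightarrow> smooth g1 \<longrightarrow> smooth g2 \<longrightarrow> smooth g3 \<longrightarrow>
       (\<forall>x. nambu_bracket L f1 f2 (nambu_bracket L g1 g2 g3) x =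
          nambu_bracket L (nambu_bracket L f1 f2 g1) g2 g3 x +
          nambu_bracket L g1 (nambu_bracket L f1 f2 g2) g3 x +
          nambu_bracket L g1 g2 (nambu_bracket L f1 f2 g3) x))"

definition sharp :: "mvfield \<Rightarrow> nat \<Rightarrow> form \<Rightarrow> mvfield" where
  "sharp L r b x = contract pd dx r (b x) (L x)"

definition hamiltonian :: "mvfield \<Rightarrow> (pt \<Rightarrow> real) \<Rightarrow> (pt \<Rightarrow> real) \<Rightarrow> mvfield" where
  "hamiltonian L f g =
     sharp L 2 (\<lambda>x. wedge [blinfun_apply (diff f x), blinfun_apply (diff g x)])"

subsection \<open>Foliated cohomology\<close>

definition char_foliation :: "mvfield \<Rightarrow> pt \<Rightarrow> pt set" where
  "char_foliation L x =
     {(\<chi> i. contract pd dx 2 b (L x) [dx i]) | b. alt_multilinear 2 b}"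

lemma Ck_const: "Ck k (\<lambda>x. c)"
  by (induction k arbitrary: c) (auto simp: frechet_derivative_const)

lemma char_foliation_eq: "(\<lambda>b. vec_of (sharp L 2 b) x) ` fields 2 = char_foliation L x"
proof (intro equalityI subsetI)
  fix v assume "v \<in> (\<lambda>b. vec_of (sharp L 2 b) x) ` fields 2"
  then show "v \<in> char_foliation L x"
    by (auto simp: char_foliation_def fields_def vec_of_def sharp_def)
next
  fix v assume "v \<in> char_foliation L x"
  then obtain b where b: "alt_multilinear 2 b"
    and v: "v = (\<chi> i. contract pd dx 2 b (L x) [dx i])"
    by (auto simp: char_foliation_def)
  have "(\<lambda>_. b) \<in> fields 2"
    using b by (simp add: fields_def smooth_def Ck_const)
  moreover have "v = vec_of (sharp L 2 (\<lambda>_. b)) x"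
    by (simp add: v vec_of_def sharp_def)
  ultimately show "v \<in> (\<lambda>b. vec_of (sharp L 2 b) x) ` fields 2"
    by (blast intro: rev_image_eqI)
qed

text \<open>
  The forms that vanish along the characteristic foliation of \<open>L\<close>, whose tangent fields are taken to
  be the fields \<open>sharp L 2 b\<close>; by \<open>char_foliation_eq\<close> these sweep out \<open>char_foliation L x\<close> at \<open>x\<close>.
\<close>
definition leaf_null_forms :: "mvfield \<Rightarrow> nat \<Rightarrow> form set" where
  "leaf_null_forms L k =
     {a \<in> fields k. \<forall>Xs. length Xs = k \<longrightarrow> set Xs \<subseteq> (\<lambda>b. vec_of (sharp L 2 b)) ` fields 2 \<longrightarrow>
        (\<forall>x. a x (map (\<lambda>X. X x) Xs) = 0)}"

definition foliated_forms :: "mvfield \<Rightarrow> nat \<Rightarrow> (pt \<Rightarrow> real, form set) module" where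
  "foliated_forms L k = quot_module (Omega k) (leaf_null_forms L k)"

definition foliated_deriv :: "mvfield \<Rightarrow> nat \<Rightarrow> form set \<Rightarrow> form set" where
  "foliated_deriv L k A =
     (\<Union>a\<in>A. leaf_null_forms L (Suc k) +>\<^bsub>Omega (Suc k)\<^esub> ext_deriv a)"

definition foliated_cohomology :: "mvfield \<Rightarrow> nat \<Rightarrow> (real, form set set) module" where
  "foliated_cohomology L = cohomology (foliated_forms L) (foliated_deriv L)"

subsection \<open>Nambu-Poisson cohomology\<close>

definition form_bracket :: "mvfield \<Rightarrow> form \<Rightarrow> form \<Rightarrow> form" where
  "form_bracket L a b x vs =
     lie_deriv (vec_of (sharp L 2 a)) b x vs - sharp L 3 (ext_deriv a) x [] * b x vs"

definition ker_sharp2 :: "mvfield \<Rightarrow> form set" where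
  "ker_sharp2 L = a_kernel (Omega 2) (Mvf 1) (sharp L 2)"

definition form_quot :: "mvfield \<Rightarrow> (pt \<Rightarrow> real, form set) module" where
  "form_quot L = quot_module (Omega 2) (ker_sharp2 L)"

type_synonym cochain = "form set list \<Rightarrow> pt \<Rightarrow> real"

text \<open>Cochains of degree \<open>k\<close> are extended by \<open>0\<close> outside the \<open>k\<close>-tuples of classes.\<close>
definition np_cochains :: "mvfield \<Rightarrow> nat \<Rightarrow> cochain set" where
  "np_cochains L k =
     (let Q = form_quot L; T = {As. length As = k \<and> set As \<subseteq> carrier Q} in
      {c. (\<forall>As. As \<notin> T \<longrightarrow> c As = (\<lambda>x. 0)) \<and>
          (\<forall>As\<in>T. smooth (c As)) \<and>
          (\<forall>As\<in>T. \<forall>i<k. \<forall>A\<in>carrier Q. \<forall>B\<in>carrier Q. \<forall>x.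
             c (As[i := A \<oplus>\<^bsub>Q\<^esub> B]) x = c (As[i := A]) x + c (As[i := B]) x) \<and>
          (\<forall>As\<in>T. \<forall>i<k. \<forall>A\<in>carrier Q. \<forall>f. smooth f \<longrightarrow> (\<forall>x.
             c (As[i := f \<odot>\<^bsub>Q\<^esub> A]) x = f x * c (As[i := A]) x)) \<and>
          (\<forall>As\<in>T. \<forall>i<k. \<forall>j<k. i \<noteq> j \<longrightarrow> (\<forall>x.
             c (As[i := As ! j, j := As ! i]) x = - c As x))})"

definition np_module :: "mvfield \<Rightarrow> nat \<Rightarrow> (pt \<Rightarrow> real, cochain) module" where
  "np_module L k =
     \<lparr>carrier = np_cochains L k, mult = undefined, one = undefined, zero = (\<lambda>As x. 0),
      add = (\<lambda>c c' As x. c As x + c' As x), smult = (\<lambda>f c As x. f x * c As x)\<rparr>"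

text \<open>
  The formula for the coboundary is evaluated on representatives \<open>a i\<close> of the classes; its value does
  not depend on them.  The sign \<open>(-1)^(i-1)\<close> is written \<open>(-1)^(i+1)\<close>, as \<open>i\<close> may be \<open>0\<close>.
\<close>
definition np_deriv :: "mvfield \<Rightarrow> nat \<Rightarrow> cochain \<Rightarrow> cochain" where
  "np_deriv L k c As x =
     (if length As = Suc k \<and> set As \<subseteq> carrier (form_quot L) then
        (let a = (\<lambda>i. SOME b. b \<in> As ! i) in
          (\<Sum>i\<le>k. (-1) ^ i * sharp L 2 (a i) x [diff (c (remove_nth i As)) x]) +
          (\<Sum>j\<le>k. \<Sum>i<j. (-1) ^ (i + 1) *
             c (remove_nth i (As[j := ker_sharp2 L +>\<^bsub>Omega 2\<^esub> form_bracket L (a i) (a j)])) x))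
      else 0)"

definition np_cohomology :: "mvfield \<Rightarrow> nat \<Rightarrow> (real, cochain set) module" where
  "np_cohomology L = cohomology (np_module L) (np_deriv L)"

subsection \<open>The modular bivector and the homology complex\<close>

definition modular_bivector :: "mvfield \<Rightarrow> form \<Rightarrow> mvfield" where
  "modular_bivector L nu =
     (THE P. P \<in> fields 2 \<and>
        (\<forall>f g. smooth f \<longrightarrow> smooth g \<longrightarrow>
           (\<forall>x. P x [diff f x, diff g x] = div_vol nu (vec_of (hamiltonian L f g)) x)))"

definition flat :: "form \<Rightarrow> nat \<Rightarrow> mvfield \<Rightarrow> form" where
  "flat nu k P x = contract dx pd k (P x) (nu x)"

text \<open>The boundary operator from \<open>k\<close>-vector fields to \<open>(k-1)\<close>-vector fields, for \<open>1 \<le> k \<le> 3\<close>.\<close>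
definition boundary :: "form \<Rightarrow> nat \<Rightarrow> mvfield \<Rightarrow> mvfield" where
  "boundary nu k P = inv_into (fields (k - 1)) (flat nu (k - 1)) (ext_deriv (flat nu k P))"

text \<open>
  A graded subspace \<open>S\<close> of the multivector fields is given by its components \<open>S k\<close>, \<open>k \<le> 3\<close>; the
  boundary operator is zero on functions.
\<close>
definition is_subcomplex :: "form \<Rightarrow> (nat \<Rightarrow> mvfield set) \<Rightarrow> bool" where
  "is_subcomplex nu S \<longleftrightarrow>
     (\<forall>k\<le>3. S k \<subseteq> carrier (Mvf k) \<and> \<zero>\<^bsub>Mvf k\<^esub> \<in> S k \<and>
        (\<forall>P\<in>S k. \<forall>P'\<in>S k. P \<oplus>\<^bsub>Mvf k\<^esub> P' \<in> S k) \<and>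
        (\<forall>a::real. \<forall>P\<in>S k. (\<lambda>_. a) \<odot>\<^bsub>Mvf k\<^esub> P \<in> S k)) \<and>
     (\<forall>k\<in>{1..3}. boundary nu k ` S k \<subseteq> S (k - 1))"

text \<open>The component of degree \<open>k\<close> of the image of all forms.\<close>
definition sharp_image :: "mvfield \<Rightarrow> nat \<Rightarrow> mvfield set" where
  "sharp_image L k = sharp L (3 - k) ` fields (3 - k)"

section \<open>The structure under consideration\<close>

definition Lambda0 :: mvfield where
  "Lambda0 x = (\<lambda>as. ((x $ 1)\<^sup>2 + (x $ 2)\<^sup>2 + (x $ 3)\<^sup>2) *
     wedge [\<lambda>a. blinfun_apply a (pd 1), \<lambda>a. blinfun_apply a (pd 2), \<lambda>a. blinfun_apply a (pd 3)] as)"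

definition nu0 :: form where
  "nu0 x = wedge [blinfun_apply (dx 1), blinfun_apply (dx 2), blinfun_apply (dx 3)]"

end

theory Submission
  imports Defs
begin

text \<open>
  Write \<open>h x = |x|\<^sup>2\<close> for the coefficient of \<open>\<Lambda>\<close> (\<open>sqn\<close> below), so that \<open>\<Lambda> = h \<partial>\<^sub>1 \<and> \<partial>\<^sub>2 \<and> \<partial>\<^sub>3\<close>.  In
  coordinates the brackets and the sharp maps are \<open>h\<close> times determinants, and \<open>h\<close> vanishes only at
  the origin.  Everything follows from these two facts and from one obstruction
  (\<open>grad_sqn_not_multiple\<close>): \<open>dh = h \<theta>\<close> has no smooth solution \<open>\<theta>\<close>, since on the first axis it would
  give \<open>2 t = t\<^sup>2 \<theta>\<^sub>1\<close>, with \<open>\<theta>\<^sub>1\<close> unbounded near \<open>0\<close>.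

  Nambu identity (\<open>nambu_poisson_Lambda0\<close>): the Hamiltonian field is \<open>X = h (\<nabla>f\<^sub>1 \<times> \<nabla>f\<^sub>2)\<close>.  As a cross
  product of gradients is divergence free, \<open>div X = \<nabla>h \<bullet> (\<nabla>f\<^sub>1 \<times> \<nabla>f\<^sub>2)\<close>, hence \<open>X h = h div X\<close>, which
  says that \<open>X\<close> preserves \<open>\<Lambda>\<close>.

  Injectivity (\<open>sharp_inj_on\<close>): each sharp map of positive degree is invertible off the origin, and
  equality extends to the origin by continuity.  The same argument shows that only the zero form
  vanishes along the foliation (\<open>leaf_null_forms_Lambda0\<close>).  The foliated complex is therefore the
  de Rham complex with every form replaced by its singleton, and its first cohomology vanishes by
  the Poincare lemma for closed 1-forms (\<open>poincare_1_forms\<close>).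

  Nambu-Poisson cohomology: let \<open>\<alpha> = i(A)\<nu>\<close> correspond to the field \<open>A\<close>.  The sharp map sends \<open>\<alpha>\<close> to
  \<open>h A\<close>, and the bracket of forms becomes \<open>h [A, B] + (A h) B - (B h) A\<close> (\<open>form_bracket_iota_nu\<close>).  The
  1-cochain \<open>\<alpha> \<mapsto> A h\<close> is the pullback of \<open>d(log h)\<close>, so it is closed.  It is not exact, because it would
  be the coboundary of a function \<open>f\<close> only if \<open>dh = h df\<close>.  So the first Nambu-Poisson cohomology
  has at least two elements, and the first foliated cohomology has one.

  Modular bivector: \<open>div X = det(\<nabla>h, \<nabla>f\<^sub>1, \<nabla>f\<^sub>2)\<close>, so the bivector is \<open>i(dh)(\<partial>\<^sub>1 \<and> \<partial>\<^sub>2 \<and> \<partial>\<^sub>3)\<close>, while the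
  image of a 1-form \<open>\<theta>\<close> is \<open>h i(\<theta>)(\<partial>\<^sub>1 \<and> \<partial>\<^sub>2 \<and> \<partial>\<^sub>3)\<close>; the obstruction applies.  It applies again to
  the boundary of \<open>\<Lambda>\<close> itself, which corresponds to \<open>dh\<close> although \<open>\<Lambda>\<close> is the image of the function \<open>1\<close>.
\<close>

unbundle cross3_syntax

section \<open>Exterior algebra of three-space in coordinates\<close>

text \<open>In the index type the numeral \<open>3\<close> is \<open>0\<close>, whence the order \<open>3 < 1 < 2\<close>.\<close>
lemma index3_less:
  "(3::3) < 1" "(1::3) < 2" "(3::3) < 2" "\<not> (1::3) < 3" "\<not> (2::3) < 3" "\<not> (2::3) < 1"
  by (simp_all add: less_bit1_def bit1.Rep_1 bit1.Rep_numeral)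

lemma sorted_index3_lists:
  "{is :: 3 list. length is = 0 \<and> sorted_wrt (<) is} = {[]}"
  "{is :: 3 list. length is = 1 \<and> sorted_wrt (<) is} = {[1], [2], [3]}"
  "{is :: 3 list. length is = 2 \<and> sorted_wrt (<) is} = {[3, 1], [3, 2], [1, 2]}"
  "{is :: 3 list. length is = 3 \<and> sorted_wrt (<) is} = {[3, 1, 2]}"
proof -
  have e: "i = 1 \<or> i = 2 \<or> i = 3" for i :: 3 by (rule exhaust_3)
  show "{is :: 3 list. length is = 0 \<and> sorted_wrt (<) is} = {[]}" by auto
  show "{is :: 3 list. length is = 1 \<and> sorted_wrt (<) is} = {[1], [2], [3]}"
    using e by (auto simp: length_Suc_conv)
  show "{is :: 3 list. length is = 2 \<and> sorted_wrt (<) is} = {[3, 1], [3, 2], [1, 2]}"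
  proof (intro equalityI subsetI)
    fix l :: "3 list" assume "l \<in> {is. length is = 2 \<and> sorted_wrt (<) is}"
    then obtain i j where l: "l = [i, j]" and "i < j"
      by (auto simp: length_Suc_conv numeral_2_eq_2)
    then show "l \<in> {[3, 1], [3, 2], [1, 2]}"
      using e[of i] e[of j] index3_less by auto
  qed (auto simp: index3_less)
  show "{is :: 3 list. length is = 3 \<and> sorted_wrt (<) is} = {[3, 1, 2]}"
  proof (intro equalityI subsetI)
    fix l :: "3 list" assume "l \<in> {is. length is = 3 \<and> sorted_wrt (<) is}"
    then obtain i j k where l: "l = [i, j, k]" and "i < j" "j < k"
      by (auto simp: length_Suc_conv numeral_3_eq_3)
    then show "l \<in> {[3, 1, 2]}"
      using e[of i] e[of j] e[of k] index3_less by auto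
  qed (auto simp: index3_less)
qed

lemma contract_0: "contract e e' 0 b P ws = b [] * P ws"
  unfolding contract_def sorted_index3_lists by simp

lemma contract_1:
  "contract e e' 1 b P ws = b [e 1] * P (e' 1 # ws) + b [e 2] * P (e' 2 # ws) + b [e 3] * P (e' 3 # ws)"
  unfolding contract_def sorted_index3_lists by simp

lemma contract_2:
  "contract e e' 2 b P ws =
     b [e 1, e 2] * P (e' 1 # e' 2 # ws) + b [e 3, e 1] * P (e' 3 # e' 1 # ws) +
     b [e 3, e 2] * P (e' 3 # e' 2 # ws)"
  unfolding contract_def sorted_index3_lists by simp

lemma contract_3: "contract e e' 3 b P ws = b [e 3, e 1, e 2] * P (e' 3 # e' 1 # e' 2 # ws)"
  unfolding contract_def sorted_index3_lists by simp

lemma wedge_length: "length vs \<noteq> length fs \<Longrightarrow> wedge fs vs = 0"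
  by (simp add: wedge_def)

lemma wedge_2: "wedge [f, g] [u, v] = f u * g v - f v * g u"
proof -
  have "{..<2::nat} = {0, 1}" by auto
  moreover have "(\<Sum>p | p permutes {0, 1::nat}. of_int (sign p) * (\<Prod>i\<in>{0, 1}. ([f, g] ! i) ([u, v] ! p i)))
    = f u * g v - f v * g u"
    by (subst sum_over_permutations_insert, simp, simp, unfold permutes_sing)
       (simp add: sign_swap_id permutation_swap_id sign_compose sign_id swap_id_eq)
  ultimately show ?thesis by (simp add: wedge_def numeral_2_eq_2)
qed

lemma wedge_3:
  "wedge [f, g, h] [u, v, w] =
     f u * g v * h w + f v * g w * h u + f w * g u * h v
     - f u * g w * h v - f v * g u * h w - f w * g v * h u"
proof -
  have s: "{..<3::nat} = {0, 1, 2}" by auto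
  have "(\<Sum>p | p permutes {0, 1, 2::nat}. of_int (sign p) * (\<Prod>i\<in>{0, 1, 2}. ([f, g, h] ! i) ([u, v, w] ! p i)))
    = f u * g v * h w + f v * g w * h u + f w * g u * h v
     - f u * g w * h v - f v * g u * h w - f w * g v * h u"
    apply (subst sum_over_permutations_insert, simp, simp)
    apply (subst sum_over_permutations_insert, simp, simp)
    unfolding permutes_sing
    by (simp add: sign_swap_id permutation_swap_id sign_compose sign_id swap_id_eq)
  then show ?thesis using s by (simp add: wedge_def numeral_3_eq_3)
qed

text \<open>The component vector of a covector; it identifies covectors with vectors.\<close>
definition cov :: "covec \<Rightarrow> pt" where
  "cov a = (\<chi> i. blinfun_apply a (pd i))"

lemma pd_nth: "pd i $ j = (if j = i then 1 else 0)"
  by (simp add: pd_def axis_def)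

lemma cov_nth: "cov a $ i = blinfun_apply a (pd i)"
  by (simp add: cov_def)

lemma linear_expand3:
  fixes f :: "pt \<Rightarrow> real"
  assumes "linear f"
  shows "f v = v $ 1 * f (pd 1) + v $ 2 * f (pd 2) + v $ 3 * f (pd 3)"
proof -
  have "v = v $ 1 *\<^sub>R pd 1 + v $ 2 *\<^sub>R pd 2 + v $ 3 *\<^sub>R pd 3"
    by (auto simp: vec_eq_iff forall_3 pd_nth)
  then have "f v = f (v $ 1 *\<^sub>R pd 1 + v $ 2 *\<^sub>R pd 2 + v $ 3 *\<^sub>R pd 3)" by simp
  also have "\<dots> = v $ 1 * f (pd 1) + v $ 2 * f (pd 2) + v $ 3 * f (pd 3)"
    using assms by (simp add: linear_add linear_cmul)
  finally show ?thesis .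
qed

lemma inner3: "(u::pt) \<bullet> v = u $ 1 * v $ 1 + u $ 2 * v $ 2 + u $ 3 * v $ 3"
  by (simp add: inner_vec_def sum_3)

lemma blinfun_apply_eq_cov: "blinfun_apply a v = cov a \<bullet> v"
  using linear_expand3[OF bounded_linear.linear[OF blinfun.bounded_linear_right], of a v]
  by (simp add: inner3 cov_nth mult.commute)

lemma cov_add: "cov (a + b) = cov a + cov b"
  by (simp add: cov_def vec_eq_iff blinfun.add_left)

lemma cov_scaleR: "cov (c *\<^sub>R a) = c *\<^sub>R cov a"
  by (simp add: cov_def vec_eq_iff blinfun.scaleR_left)

lemma cov_dx: "cov (dx i) = pd i"
proof -
  have "bounded_linear (\<lambda>v::pt. v $ i)" by (rule bounded_linear_vec_nth)
  then show ?thesis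
    by (auto simp: cov_def dx_def vec_eq_iff pd_nth bounded_linear_Blinfun_apply)
qed

lemma dx_apply: "blinfun_apply (dx i) v = v $ i"
  by (simp add: blinfun_apply_eq_cov cov_dx pd_def inner_axis')

text \<open>The component vector of a 1-form at a point.\<close>
definition star1 :: "(pt list \<Rightarrow> real) \<Rightarrow> pt" where
  "star1 b = (\<chi> i. b [pd i])"

text \<open>
  The vector \<open>A\<close> with \<open>b = i(A) (dx\<^sub>1 \<and> dx\<^sub>2 \<and> dx\<^sub>3)\<close>, for an alternating 2-form \<open>b\<close> at a point; see
  \<open>alt2_expand\<close>.
\<close>
definition star2 :: "(pt list \<Rightarrow> real) \<Rightarrow> pt" where
  "star2 b = vector [b [pd 2, pd 3], b [pd 3, pd 1], b [pd 1, pd 2]]"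

lemma star1_nth: "star1 b $ i = b [pd i]"
  by (simp add: star1_def)

lemma star2_nth:
  "star2 b $ 1 = b [pd 2, pd 3]" "star2 b $ 2 = b [pd 3, pd 1]" "star2 b $ 3 = b [pd 1, pd 2]"
  by (simp_all add: star2_def vector_3)

text \<open>The determinant with rows \<open>u\<close>, \<open>v\<close>, \<open>w\<close>, as a triple product.\<close>
definition det3 :: "pt \<Rightarrow> pt \<Rightarrow> pt \<Rightarrow> real" where
  "det3 u v w = u \<bullet> (v \<times> w)"

lemma cross3_nth:
  "(u \<times> v) $ 1 = u $ 2 * v $ 3 - u $ 3 * v $ 2"
  "(u \<times> v) $ 2 = u $ 3 * v $ 1 - u $ 1 * v $ 3"
  "(u \<times> v) $ 3 = u $ 1 * v $ 2 - u $ 2 * v $ 1"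
  by (simp_all add: cross3_def vector_3)

lemma det3_expand:
  "det3 u v w = u $ 1 * (v $ 2 * w $ 3 - v $ 3 * w $ 2) + u $ 2 * (v $ 3 * w $ 1 - v $ 1 * w $ 3)
     + u $ 3 * (v $ 1 * w $ 2 - v $ 2 * w $ 1)"
  by (simp add: det3_def inner3 cross3_nth)

lemma alt_length: "alt_multilinear k w \<Longrightarrow> length vs \<noteq> k \<Longrightarrow> w vs = 0"
  by (simp add: alt_multilinear_def)

lemma alt_multilinear_0_iff: "alt_multilinear 0 w \<longleftrightarrow> (\<forall>vs. length vs \<noteq> 0 \<longrightarrow> w vs = 0)"
  by (simp add: alt_multilinear_def)

lemma alt_multilinear_1_iff:
  "alt_multilinear 1 w \<longleftrightarrow> (\<forall>vs. length vs \<noteq> 1 \<longrightarrow> w vs = 0) \<and> linear (\<lambda>v. w [v])"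
proof -
  have "(\<forall>vs i. length vs = 1 \<longrightarrow> i < 1 \<longrightarrow> linear (\<lambda>v. w (vs[i := v]))) \<longleftrightarrow> linear (\<lambda>v. w [v])"
    (is "?L \<longleftrightarrow> ?R")
  proof
    assume ?L
    from this[rule_format, of "[undefined]" 0] show ?R by simp
  next
    assume ?R then show ?L by (auto simp: length_Suc_conv)
  qed
  then show ?thesis by (auto simp: alt_multilinear_def)
qed

lemma alt_multilinear_2_iff:
  "alt_multilinear 2 w \<longleftrightarrow> (\<forall>vs. length vs \<noteq> 2 \<longrightarrow> w vs = 0) \<and>
     (\<forall>u. linear (\<lambda>v. w [v, u])) \<and> (\<forall>u. linear (\<lambda>v. w [u, v])) \<and> (\<forall>u. w [u, u] = 0)"
proof -
  have A: "(\<forall>vs i. length vs = 2 \<longrightarrow> i < 2 \<longrightarrow> linear (\<lambda>v. w (vs[i := v]))) \<longleftrightarrow>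
    (\<forall>u. linear (\<lambda>v. w [v, u])) \<and> (\<forall>u. linear (\<lambda>v. w [u, v]))" (is "?L \<longleftrightarrow> ?R")
  proof
    assume L: ?L
    show ?R using L[rule_format, of "[undefined, _]" 0] L[rule_format, of "[_, undefined]" 1] by simp
  next
    assume ?R then show ?L by (auto simp: length_Suc_conv numeral_2_eq_2 less_Suc_eq)
  qed
  have B: "(\<forall>vs i j. length vs = 2 \<longrightarrow> i < j \<longrightarrow> j < 2 \<longrightarrow> vs ! i = vs ! j \<longrightarrow> w vs = 0) \<longleftrightarrow>
    (\<forall>u. w [u, u] = 0)" (is "?L \<longleftrightarrow> ?R")
  proof
    assume L: ?L
    show ?R using L[rule_format, of "[_, _]" 0 1] by simp
  next
    assume ?R then show ?L by (auto simp: length_Suc_conv numeral_2_eq_2 less_Suc_eq)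
  qed
  show ?thesis unfolding alt_multilinear_def A B by simp
qed

lemma alt_multilinear_3_iff:
  "alt_multilinear 3 w \<longleftrightarrow> (\<forall>vs. length vs \<noteq> 3 \<longrightarrow> w vs = 0) \<and>
     (\<forall>u u'. linear (\<lambda>v. w [v, u, u'])) \<and> (\<forall>u u'. linear (\<lambda>v. w [u, v, u'])) \<and>
     (\<forall>u u'. linear (\<lambda>v. w [u, u', v])) \<and>
     (\<forall>u v. w [u, u, v] = 0) \<and> (\<forall>u v. w [u, v, u] = 0) \<and> (\<forall>u v. w [v, u, u] = 0)"
proof -
  have A: "(\<forall>vs i. length vs = 3 \<longrightarrow> i < 3 \<longrightarrow> linear (\<lambda>v. w (vs[i := v]))) \<longleftrightarrow>
    (\<forall>u u'. linear (\<lambda>v. w [v, u, u'])) \<and> (\<forall>u u'. linear (\<lambda>v. w [u, v, u'])) \<and>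
     (\<forall>u u'. linear (\<lambda>v. w [u, u', v]))" (is "?L \<longleftrightarrow> ?R")
  proof
    assume L: ?L
    show ?R using L[rule_format, of "[undefined, _, _]" 0] L[rule_format, of "[_, undefined, _]" 1]
       L[rule_format, of "[_, _, undefined]" 2] by simp
  next
    assume ?R then show ?L by (auto simp: length_Suc_conv numeral_3_eq_3 less_Suc_eq)
  qed
  have B: "(\<forall>vs i j. length vs = 3 \<longrightarrow> i < j \<longrightarrow> j < 3 \<longrightarrow> vs ! i = vs ! j \<longrightarrow> w vs = 0) \<longleftrightarrow>
    (\<forall>u v. w [u, u, v] = 0) \<and> (\<forall>u v. w [u, v, u] = 0) \<and> (\<forall>u v. w [v, u, u] = 0)" (is "?L \<longleftrightarrow> ?R")
  proof
    assume L: ?L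
    show ?R using L[rule_format, of "[_, _, _]" 0 1] L[rule_format, of "[_, _, _]" 0 2]
      L[rule_format, of "[_, _, _]" 1 2] by simp
  next
    assume ?R then show ?L by (auto simp: length_Suc_conv numeral_3_eq_3 less_Suc_eq)
  qed
  show ?thesis unfolding alt_multilinear_def A B by simp
qed

lemma alt2_swap:
  assumes "alt_multilinear 2 w"
  shows "w [v, u] = - w [u, v]"
proof -
  have l: "linear (\<lambda>v. w [v, u])" "linear (\<lambda>v. w [u, v])" and z: "w [u, u] = 0" for u
    using assms by (simp_all add: alt_multilinear_2_iff)
  have "w [u + v, u + v] = w [u, u] + w [v, u] + (w [u, v] + w [v, v])"
    unfolding linear_add[OF l(1)] linear_add[OF l(2)] by simp
  then show ?thesis using z by simp
qed

lemma alt3_swap: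
  assumes "alt_multilinear 3 w"
  shows "w [v, u, t] = - w [u, v, t]" "w [u, t, v] = - w [u, v, t]"
proof -
  have "alt_multilinear 2 (\<lambda>vs. if length vs = 2 then w (vs @ [t]) else 0)"
    "alt_multilinear 2 (\<lambda>vs. if length vs = 2 then w (u # vs) else 0)"
    using assms by (auto simp: alt_multilinear_2_iff alt_multilinear_3_iff)
  from alt2_swap[OF this(1), of v u] alt2_swap[OF this(2), of t v]
  show "w [v, u, t] = - w [u, v, t]" "w [u, t, v] = - w [u, v, t]" by simp_all
qed

lemma alt1_expand:
  assumes "alt_multilinear 1 (w :: pt list \<Rightarrow> real)"
  shows "w [v] = star1 w \<bullet> v"
  using linear_expand3[of "\<lambda>v. w [v]" v] assms unfolding alt_multilinear_1_iff
  by (simp add: inner3 star1_nth mult.commute)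

lemma alt2_expand:
  assumes "alt_multilinear 2 (w :: pt list \<Rightarrow> real)"
  shows "w [u, v] = star2 w \<bullet> (u \<times> v)"
proof -
  have l: "linear (\<lambda>v. w [v, u])" "linear (\<lambda>v. w [u, v])" and z: "w [u, u] = 0" for u
    using assms by (simp_all add: alt_multilinear_2_iff)
  have e: "w [pd 2, pd 1] = - w [pd 1, pd 2]" "w [pd 3, pd 2] = - w [pd 2, pd 3]"
    "w [pd 1, pd 3] = - w [pd 3, pd 1]"
    by (rule alt2_swap[OF assms])+
  have "w [u, v] = u $ 1 * w [pd 1, v] + u $ 2 * w [pd 2, v] + u $ 3 * w [pd 3, v]"
    using linear_expand3[OF l(1)] .
  then show ?thesis
    unfolding linear_expand3[OF l(2), of "pd _" v]
    by (simp add: z e inner3 star2_nth cross3_nth algebra_simps)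
qed

lemma alt3_expand:
  assumes "alt_multilinear 3 (w :: pt list \<Rightarrow> real)"
  shows "w [u, v, t] = w [pd 1, pd 2, pd 3] * det3 u v t"
proof -
  have l: "linear (\<lambda>v. w [v, u, t])" "linear (\<lambda>v. w [u, v, t])" "linear (\<lambda>v. w [u, t, v])"
    and z: "w [u, u, v] = 0" "w [u, v, u] = 0" "w [v, u, u] = 0" for u v t
    using assms by (simp_all add: alt_multilinear_3_iff)
  have e: "w [pd 2, pd 1, pd 3] = - w [pd 1, pd 2, pd 3]" "w [pd 1, pd 3, pd 2] = - w [pd 1, pd 2, pd 3]"
     "w [pd 2, pd 3, pd 1] = w [pd 1, pd 2, pd 3]" "w [pd 3, pd 1, pd 2] = w [pd 1, pd 2, pd 3]"
     "w [pd 3, pd 2, pd 1] = - w [pd 1, pd 2, pd 3]"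
    using alt3_swap(1)[OF assms, of "pd 2" "pd 1" "pd 3"] alt3_swap(2)[OF assms, of "pd 1" "pd 3" "pd 2"]
      alt3_swap(2)[OF assms, of "pd 2" "pd 3" "pd 1"] alt3_swap(1)[OF assms, of "pd 3" "pd 1" "pd 2"]
      alt3_swap(1)[OF assms, of "pd 3" "pd 2" "pd 1"] alt3_swap(2)[OF assms, of "pd 3" "pd 2" "pd 1"]
    by simp_all
  have "w [u, v, t] = u $ 1 * w [pd 1, v, t] + u $ 2 * w [pd 2, v, t] + u $ 3 * w [pd 3, v, t]"
    using linear_expand3[OF l(1)] .
  moreover have "w [pd i, v, t] = v $ 1 * w [pd i, pd 1, t] + v $ 2 * w [pd i, pd 2, t] + v $ 3 * w [pd i, pd 3, t]" for i
    using linear_expand3[OF l(2)] .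
  moreover have "w [pd i, pd j, t] = t $ 1 * w [pd i, pd j, pd 1] + t $ 2 * w [pd i, pd j, pd 2] + t $ 3 * w [pd i, pd j, pd 3]" for i j
    using linear_expand3[OF l(3)] .
  ultimately show ?thesis
    by (simp add: z e det3_expand algebra_simps)
qed

section \<open>Smooth functions\<close>

text \<open>The vector of partial derivatives; meaningful only where \<open>f\<close> is differentiable.\<close>
definition grad :: "(pt \<Rightarrow> real) \<Rightarrow> pt \<Rightarrow> pt" where
  "grad f x = (\<chi> i. frechet_derivative f (at x) (pd i))"

lemma Ck_Suc_imp_Ck: "Ck (Suc k) f \<Longrightarrow> Ck k f"
proof (induction k arbitrary: f)
  case 0
  then show ?case
    by (auto intro!: continuous_at_imp_continuous_on differentiable_imp_continuous_within)
next
  case (Suc k)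
  then show ?case by (metis Ck.simps(2))
qed

lemma Ck_add: "Ck k f \<Longrightarrow> Ck k g \<Longrightarrow> Ck k (\<lambda>x. f x + g x)"
proof (induction k arbitrary: f g)
  case 0
  then show ?case by (auto intro: continuous_intros)
next
  case (Suc k)
  have "((\<lambda>x. f x + g x) has_derivative
      (\<lambda>v. frechet_derivative f (at x) v + frechet_derivative g (at x) v)) (at x)" for x
    using Suc.prems by (intro has_derivative_add) (auto simp: frechet_derivative_works)
  from frechet_derivative_at[OF this, symmetric] show ?case
    using Suc by (auto intro: differentiable_add)
qed

lemma Ck_mult: "Ck k f \<Longrightarrow> Ck k g \<Longrightarrow> Ck k (\<lambda>x. f x * g x)"
proof (induction k arbitrary: f g)
  case 0
  then show ?case by (auto intro: continuous_intros)
next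
  case (Suc k)
  have *: "((\<lambda>x. f x * g x) has_derivative
      (\<lambda>v. f x * frechet_derivative g (at x) v + frechet_derivative f (at x) v * g x)) (at x)" for x
    using Suc.prems by (intro has_derivative_mult) (auto simp: frechet_derivative_works)
  then have "(\<lambda>x. f x * g x) differentiable at x" for x
    using differentiable_def by blast
  with frechet_derivative_at[OF *, symmetric] show ?case
    using Suc Ck_Suc_imp_Ck[OF Suc.prems(1)] Ck_Suc_imp_Ck[OF Suc.prems(2)] by (auto intro!: Ck_add)
qed

lemma smooth_const [simp, intro]: "smooth (\<lambda>x. c)"
  by (simp add: smooth_def Ck_const)

lemma smooth_add [intro]: "smooth f \<Longrightarrow> smooth g \<Longrightarrow> smooth (\<lambda>x. f x + g x)"
  by (simp add: smooth_def Ck_add)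

lemma smooth_mult [intro]: "smooth f \<Longrightarrow> smooth g \<Longrightarrow> smooth (\<lambda>x. f x * g x)"
  by (simp add: smooth_def Ck_mult)

lemma smooth_minus [intro]: "smooth f \<Longrightarrow> smooth (\<lambda>x. - f x)"
  using smooth_mult[of "\<lambda>_. -1" f] by simp

lemma smooth_diff [intro]: "smooth f \<Longrightarrow> smooth g \<Longrightarrow> smooth (\<lambda>x. f x - g x)"
  using smooth_add[of f "\<lambda>x. - g x"] by (simp add: smooth_minus)

lemma smooth_linear: assumes "linear f" shows "smooth f"
  unfolding smooth_def
proof
  fix k
  have d: "(f has_derivative f) (at x)" for x
    using assms by (simp add: linear_imp_has_derivative)
  then have "f differentiable at x" for x using differentiable_def by blast
  then show "Ck k f"
    by (cases k) (auto simp: frechet_derivative_at[OF d, symmetric] Ck_const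
      intro!: continuous_at_imp_continuous_on differentiable_imp_continuous_within)
qed

lemma smooth_nth [simp, intro]: "smooth (\<lambda>x. x $ i)"
  by (rule smooth_linear) (simp add: linear_iff)

lemma smooth_differentiable: "smooth f \<Longrightarrow> f differentiable (at x)"
  unfolding smooth_def by (metis Ck.simps(2))

lemma smooth_continuous_on: "smooth f \<Longrightarrow> continuous_on S f"
  by (meson Ck.simps(1) continuous_on_subset smooth_def subset_UNIV)

lemma smooth_frechet_derivative: "smooth f \<Longrightarrow> smooth (\<lambda>x. frechet_derivative f (at x) v)"
  unfolding smooth_def by (metis Ck.simps(2))

lemma smoothI:
  assumes "\<And>x. f differentiable (at x)" "\<And>v. smooth (\<lambda>x. frechet_derivative f (at x) v)"
  shows "smooth f"
  unfolding smooth_def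
proof
  fix k show "Ck k f"
    by (rule Ck_Suc_imp_Ck) (use assms in \<open>auto simp: smooth_def\<close>)
qed

lemma smooth_grad [intro]: "smooth f \<Longrightarrow> smooth (\<lambda>x. grad f x $ i)"
  by (simp add: grad_def smooth_frechet_derivative)

lemma frechet_derivative_eq_grad:
  assumes "f differentiable (at x)" shows "frechet_derivative f (at x) v = grad f x \<bullet> v"
  using linear_expand3[OF linear_frechet_derivative[OF assms], of v]
  by (simp add: inner3 grad_def mult.commute)

lemma smooth_has_derivative: "smooth f \<Longrightarrow> (f has_derivative (\<lambda>v. grad f x \<bullet> v)) (at x)"
  using smooth_differentiable[of f x] frechet_derivative_eq_grad[of f x]
  by (metis (no_types, lifting) ext frechet_derivative_works)

lemma grad_eqI: "(f has_derivative (\<lambda>v. g \<bullet> v)) (at x) \<Longrightarrow> grad f x = g"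
  by (simp add: grad_def vec_eq_iff frechet_derivative_at[symmetric] pd_def inner_axis)

lemma grad_const [simp]: "grad (\<lambda>x. c) x = 0"
  by (rule grad_eqI) simp

lemma grad_add: "smooth f \<Longrightarrow> smooth g \<Longrightarrow> grad (\<lambda>x. f x + g x) x = grad f x + grad g x"
  by (rule grad_eqI) (auto simp: inner_add_left intro!: has_derivative_add smooth_has_derivative)

lemma grad_mult:
  "smooth f \<Longrightarrow> smooth g \<Longrightarrow> grad (\<lambda>x. f x * g x) x = f x *\<^sub>R grad g x + g x *\<^sub>R grad f x"
  by (rule grad_eqI)
    (auto simp: inner_add_left mult.commute intro!: has_derivative_mult[THEN has_derivative_eq_rhs] smooth_has_derivative)

lemma grad_diff: "smooth f \<Longrightarrow> smooth g \<Longrightarrow> grad (\<lambda>x. f x - g x) x = grad f x - grad g x"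
  by (rule grad_eqI) (auto simp: inner_diff_left intro!: has_derivative_diff smooth_has_derivative)

lemma grad_linear: "grad (\<lambda>x. w \<bullet> x) x = w"
  by (rule grad_eqI) (auto intro!: derivative_eq_intros)

lemma blinfun_apply_diff:
  assumes "smooth f" shows "blinfun_apply (diff f x) v = grad f x \<bullet> v"
proof -
  have "frechet_derivative f (at x) = (\<lambda>v. grad f x \<bullet> v)"
    using frechet_derivative_eq_grad[OF smooth_differentiable[OF assms]] by (rule ext)
  then show ?thesis by (simp add: diff_def bounded_linear_Blinfun_apply bounded_linear_inner_right)
qed

lemma cov_diff: "smooth f \<Longrightarrow> cov (diff f x) = grad f x"
  by (simp add: cov_def vec_eq_iff blinfun_apply_diff pd_def inner_axis)

lemma exists_linear_diff: "\<exists>f. smooth f \<and> (\<forall>x. diff f x = a)"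
proof (intro exI conjI allI)
  show s: "smooth (\<lambda>x. cov a \<bullet> x)" by (rule smooth_linear) (simp add: linear_iff inner_add_right)
  fix x show "diff (\<lambda>x. cov a \<bullet> x) x = a"
    unfolding blinfun_apply_inject[symmetric]
    by (rule ext) (simp add: cov_diff[OF s] grad_linear blinfun_apply_eq_cov)
qed

text \<open>
  The mean value theorem, applied first along \<open>u\<close> and then along \<open>v\<close>, expresses the second difference
  by a mixed second derivative at a nearby point.
\<close>
lemma second_difference_mvt:
  assumes f: "smooth f" and e: "e > 0"
  obtains y where "norm (y - x) \<le> e * (norm u + norm v)"
    "f (x + e *\<^sub>R u + e *\<^sub>R v) - f (x + e *\<^sub>R u) - f (x + e *\<^sub>R v) + f x =
     e * e * frechet_derivative (\<lambda>z. frechet_derivative f (at z) u) (at y) v"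
proof -
  define g where "g = (\<lambda>z. frechet_derivative f (at z) u)"
  have g: "smooth g" unfolding g_def using f by (rule smooth_frechet_derivative)
  have l: "((\<lambda>s. k (a + s *\<^sub>R w)) has_real_derivative frechet_derivative k (at (a + s *\<^sub>R w)) w) (at s)"
    if "smooth k" for k a w s
  proof -
    have "(k has_derivative frechet_derivative k (at (a + s *\<^sub>R w))) (at (a + s *\<^sub>R w))"
      using smooth_differentiable[OF that] by (simp add: frechet_derivative_works)
    then have "((\<lambda>s. k (a + s *\<^sub>R w)) has_derivative (\<lambda>t. frechet_derivative k (at (a + s *\<^sub>R w)) (t *\<^sub>R w))) (at s)"
      by (rule has_derivative_compose[rotated]) (auto intro!: derivative_eq_intros)
    moreover have "frechet_derivative k (at (a + s *\<^sub>R w)) (t *\<^sub>R w) = frechet_derivative k (at (a + s *\<^sub>R w)) w * t" for t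
      using linear_cmul[OF linear_frechet_derivative[OF smooth_differentiable[OF that]]] by simp
    ultimately show ?thesis by (simp add: has_field_derivative_def)
  qed
  have "\<exists>\<sigma>>0. \<sigma> < e \<and> (f (x + e *\<^sub>R v + e *\<^sub>R u) - f (x + e *\<^sub>R u)) - (f (x + e *\<^sub>R v + 0 *\<^sub>R u) - f (x + 0 *\<^sub>R u)) =
     (e - 0) * (g (x + e *\<^sub>R v + \<sigma> *\<^sub>R u) - g (x + \<sigma> *\<^sub>R u))"
    unfolding g_def by (rule MVT2[OF e]) (intro DERIV_diff l f)
  then obtain \<sigma> where \<sigma>: "0 < \<sigma>" "\<sigma> < e" and 1: "f (x + e *\<^sub>R v + e *\<^sub>R u) - f (x + e *\<^sub>R u) - f (x + e *\<^sub>R v) + f x =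
     e * (g (x + e *\<^sub>R v + \<sigma> *\<^sub>R u) - g (x + \<sigma> *\<^sub>R u))" by auto
  have "\<exists>\<tau>>0. \<tau> < e \<and> g (x + \<sigma> *\<^sub>R u + e *\<^sub>R v) - g (x + \<sigma> *\<^sub>R u + 0 *\<^sub>R v) =
     (e - 0) * frechet_derivative g (at (x + \<sigma> *\<^sub>R u + \<tau> *\<^sub>R v)) v"
    by (rule MVT2[OF e]) (intro l g)
  then obtain \<tau> where \<tau>: "0 < \<tau>" "\<tau> < e" and 2: "g (x + \<sigma> *\<^sub>R u + e *\<^sub>R v) - g (x + \<sigma> *\<^sub>R u) =
     e * frechet_derivative g (at (x + \<sigma> *\<^sub>R u + \<tau> *\<^sub>R v)) v" by auto
  have "norm (x + \<sigma> *\<^sub>R u + \<tau> *\<^sub>R v - x) \<le> \<sigma> * norm u + \<tau> * norm v"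
    using norm_triangle_ineq[of "\<sigma> *\<^sub>R u" "\<tau> *\<^sub>R v"] \<sigma> \<tau> by (simp add: add.assoc)
  also have "\<dots> \<le> e * norm u + e * norm v"
    using \<sigma> \<tau> by (intro add_mono mult_right_mono) auto
  finally have "norm (x + \<sigma> *\<^sub>R u + \<tau> *\<^sub>R v - x) \<le> e * (norm u + norm v)"
    by (simp add: distrib_left)
  moreover have "f (x + e *\<^sub>R u + e *\<^sub>R v) - f (x + e *\<^sub>R u) - f (x + e *\<^sub>R v) + f x =
     e * e * frechet_derivative g (at (x + \<sigma> *\<^sub>R u + \<tau> *\<^sub>R v)) v"
    using 1 2 by (simp add: algebra_simps)
  ultimately show ?thesis using that unfolding g_def by blast
qed

text \<open>
  The second difference is symmetric in \<open>u\<close> and \<open>v\<close>; letting the step tend to \<open>0\<close> gives the claim by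
  continuity of the mixed derivatives.
\<close>
lemma second_derivative_symmetric:
  assumes f: "smooth f"
  shows "frechet_derivative (\<lambda>z. frechet_derivative f (at z) u) (at x) v =
         frechet_derivative (\<lambda>z. frechet_derivative f (at z) v) (at x) u"
proof -
  define G where "G = (\<lambda>u v y. frechet_derivative (\<lambda>z. frechet_derivative f (at z) u) (at y) v)"
  have c: "continuous_on UNIV (G u v)" for u v
    unfolding G_def by (intro smooth_continuous_on smooth_frechet_derivative f)
  have "\<bar>G u v x - G v u x\<bar> \<le> 0"
  proof (rule field_le_epsilon)
    fix r :: real assume "r > 0"
    then obtain d1 d2 where d: "d1 > 0" "d2 > 0"
      and d1: "\<And>y. dist y x < d1 \<Longrightarrow> dist (G u v y) (G u v x) < r / 2"
      and d2: "\<And>y. dist y x < d2 \<Longrightarrow> dist (G v u y) (G v u x) < r / 2"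
      using c[of u v] c[of v u] unfolding continuous_on_iff by (metis UNIV_I half_gt_zero)
    define N where "N = norm u + norm v + 1"
    define e where "e = min d1 d2 / (2 * N)"
    have N: "N > 0" unfolding N_def by (simp add: add_nonneg_pos)
    have e: "e > 0" using d N by (simp add: e_def)
    have "e * (norm u + norm v) \<le> e * N" using e by (simp add: N_def)
    also have "e * N = min d1 d2 / 2" using N by (simp add: e_def)
    finally have b: "e * (norm u + norm v) < min d1 d2" using d by linarith
    obtain y1 where y1: "norm (y1 - x) \<le> e * (norm u + norm v)"
       "f (x + e *\<^sub>R u + e *\<^sub>R v) - f (x + e *\<^sub>R u) - f (x + e *\<^sub>R v) + f x = e * e * G u v y1"
      unfolding G_def by (rule second_difference_mvt[OF f e])
    obtain y2 where y2: "norm (y2 - x) \<le> e * (norm v + norm u)"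
       "f (x + e *\<^sub>R v + e *\<^sub>R u) - f (x + e *\<^sub>R v) - f (x + e *\<^sub>R u) + f x = e * e * G v u y2"
      unfolding G_def by (rule second_difference_mvt[OF f e])
    have sw: "x + e *\<^sub>R v + e *\<^sub>R u = x + e *\<^sub>R u + e *\<^sub>R v" by (simp add: algebra_simps)
    have "e * e * G u v y1 = e * e * G v u y2" using y1(2) y2(2)[unfolded sw] by linarith
    then have "G u v y1 = G v u y2" using e by simp
    moreover have "\<bar>G u v y1 - G u v x\<bar> < r / 2"
      using d1[of y1] y1(1) b by (simp add: dist_norm)
    moreover have "\<bar>G v u y2 - G v u x\<bar> < r / 2"
      using d2[of y2] y2(1) b by (simp add: dist_norm add.commute)
    ultimately show "\<bar>G u v x - G v u x\<bar> \<le> 0 + r" by linarith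
  qed
  then show ?thesis by (simp add: G_def)
qed

lemma grad_symmetric:
  "smooth f \<Longrightarrow> grad (\<lambda>z. grad f z $ i) x $ j = grad (\<lambda>z. grad f z $ j) x $ i"
  using second_derivative_symmetric[of f "pd i" x "pd j"] by (simp add: grad_def)

lemma smooth_eq_off_origin:
  assumes f: "smooth f" and g: "smooth g" and eq: "\<And>x. x \<noteq> 0 \<Longrightarrow> f x = g x"
  shows "f x = g x"
proof (cases "x = 0")
  case True
  have "(f \<longlongrightarrow> f 0) (at 0)" "(g \<longlongrightarrow> g 0) (at 0)"
    using smooth_continuous_on[OF f, of UNIV] smooth_continuous_on[OF g, of UNIV]
    by (simp_all add: continuous_on_def)
  moreover have "(f \<longlongrightarrow> l) (at 0) = (g \<longlongrightarrow> l) (at 0)" for l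
    by (rule tendsto_cong) (auto simp: eventually_at eq intro: exI[of _ 1])
  ultimately have "f 0 = g 0"
    using tendsto_unique[of "at (0::pt)" f "f 0" "g 0"] by simp
  then show ?thesis using True by simp
qed (use eq in auto)

section \<open>Vector calculus\<close>

text \<open>Smooth vector fields, as maps with smooth components.\<close>
definition vsmooth :: "(pt \<Rightarrow> pt) \<Rightarrow> bool" where
  "vsmooth u \<longleftrightarrow> (\<forall>i. smooth (\<lambda>x. u x $ i))"

lemma vsmooth_nth: "vsmooth u \<Longrightarrow> smooth (\<lambda>x. u x $ i)"
  by (simp add: vsmooth_def)

lemma vsmooth_grad: "smooth f \<Longrightarrow> vsmooth (grad f)"
  by (simp add: vsmooth_def smooth_grad)

lemma vsmooth_const: "vsmooth (\<lambda>x. c)"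
  by (simp add: vsmooth_def)

lemma vsmooth_scaleR: "smooth f \<Longrightarrow> vsmooth u \<Longrightarrow> vsmooth (\<lambda>x. f x *\<^sub>R u x)"
  by (simp add: vsmooth_def smooth_mult)

lemma vsmooth_cross3: "vsmooth u \<Longrightarrow> vsmooth v \<Longrightarrow> vsmooth (\<lambda>x. u x \<times> v x)"
  unfolding vsmooth_def forall_3 cross3_nth by (auto intro!: smooth_diff smooth_mult)

lemma smooth_inner: "vsmooth u \<Longrightarrow> vsmooth v \<Longrightarrow> smooth (\<lambda>x. u x \<bullet> v x)"
  unfolding vsmooth_def inner3 by (auto intro!: smooth_add smooth_mult)

lemma smooth_det3: "vsmooth u \<Longrightarrow> vsmooth v \<Longrightarrow> vsmooth w \<Longrightarrow> smooth (\<lambda>x. det3 (u x) (v x) (w x))"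
  unfolding det3_def by (intro smooth_inner vsmooth_cross3)

text \<open>The Jacobian matrix of \<open>u\<close> at \<open>x\<close>, applied to \<open>v\<close>.\<close>
definition jac :: "(pt \<Rightarrow> pt) \<Rightarrow> pt \<Rightarrow> pt \<Rightarrow> pt" where
  "jac u x v = (\<chi> i. grad (\<lambda>z. u z $ i) x \<bullet> v)"

text \<open>The divergence, that is the trace of the Jacobian matrix.\<close>
definition divg :: "(pt \<Rightarrow> pt) \<Rightarrow> pt \<Rightarrow> real" where
  "divg u x = grad (\<lambda>z. u z $ 1) x $ 1 + grad (\<lambda>z. u z $ 2) x $ 2 + grad (\<lambda>z. u z $ 3) x $ 3"

lemma jac_nth: "jac u x v $ i = grad (\<lambda>z. u z $ i) x \<bullet> v"
  by (simp add: jac_def)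

lemma vsmooth_has_derivative:
  assumes "vsmooth u" shows "(u has_derivative jac u x) (at x)"
proof -
  have "((\<lambda>y. u y \<bullet> b) has_derivative (\<lambda>v. jac u x v \<bullet> b)) (at x)" if b: "b \<in> Basis" for b
  proof -
    obtain i where "b = axis i 1" using b by (auto simp: Basis_vec_def)
    then show ?thesis
      using smooth_has_derivative[OF vsmooth_nth[OF assms], of i x] by (simp add: inner_axis jac_nth)
  qed
  then show ?thesis by (subst has_derivative_componentwise_within) simp
qed

lemma frechet_derivative_eq_jac: "vsmooth u \<Longrightarrow> frechet_derivative u (at x) = jac u x"
  using frechet_derivative_at[OF vsmooth_has_derivative] by simp

lemma grad_inner:
  "vsmooth u \<Longrightarrow> vsmooth v \<Longrightarrow>
     grad (\<lambda>x. u x \<bullet> v x) x \<bullet> y = jac u x y \<bullet> v x + u x \<bullet> jac v x y"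
  unfolding vsmooth_def inner3[of "u _" "v _"]
  by (simp add: grad_add grad_mult smooth_add smooth_mult inner_add_left)
    (simp add: inner3[of "jac _ _ _"] inner3[of _ "jac _ _ _"] jac_nth)

lemma jac_cross3:
  "vsmooth u \<Longrightarrow> vsmooth v \<Longrightarrow>
     jac (\<lambda>x. u x \<times> v x) x y = jac u x y \<times> v x + u x \<times> jac v x y"
  unfolding vsmooth_def vec_eq_iff forall_3 jac_nth cross3_nth vector_add_component
  by (simp add: grad_diff grad_mult smooth_diff smooth_mult inner_add_left inner_diff_left)

lemma grad_det3:
  assumes "vsmooth u" "vsmooth v" "vsmooth w"
  shows "grad (\<lambda>x. det3 (u x) (v x) (w x)) x \<bullet> y =
     det3 (jac u x y) (v x) (w x) + det3 (u x) (jac v x y) (w x) + det3 (u x) (v x) (jac w x y)"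
  using assms by (simp add: det3_def grad_inner jac_cross3 vsmooth_cross3 inner_add_right)

lemma jac_grad_symmetric:
  "smooth f \<Longrightarrow> jac (grad f) x y \<bullet> z = jac (grad f) x z \<bullet> y"
  by (simp add: inner3 jac_nth grad_symmetric[of f 2 x 1] grad_symmetric[of f 3 x 1]
      grad_symmetric[of f 3 x 2] algebra_simps)

text \<open>The derivative of the determinant along a linear map \<open>T\<close> with rows \<open>A i\<close> is the trace of \<open>T\<close>.\<close>
lemma det3_trace:
  assumes T: "\<And>p. T p = (\<chi> i. A i \<bullet> p)"
  shows "det3 (T p) q r + det3 p (T q) r + det3 p q (T r) = (A 1 $ 1 + A 2 $ 2 + A 3 $ 3) * det3 p q r"
  unfolding T by (simp add: det3_expand inner3 algebra_simps)

lemma divg_scaleR: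
  "smooth f \<Longrightarrow> vsmooth u \<Longrightarrow> divg (\<lambda>x. f x *\<^sub>R u x) x = f x * divg u x + grad f x \<bullet> u x"
  by (simp add: divg_def vsmooth_def grad_mult inner3 algebra_simps)

lemma divg_cross_grad:
  assumes "smooth f" "smooth g"
  shows "divg (\<lambda>x. grad f x \<times> grad g x) x = 0"
  unfolding divg_def cross3_nth using assms
  by (simp add: grad_diff grad_mult smooth_grad smooth_mult grad_symmetric[of _ 2 x 1]
      grad_symmetric[of _ 3 x 1] grad_symmetric[of _ 3 x 2])

lemma jac_const: "jac (\<lambda>x. c) x y = 0"
  by (simp add: jac_def vec_eq_iff)

lemma jac_scaleR_right: "jac u x (c *\<^sub>R y) = c *\<^sub>R jac u x y"
  by (simp add: jac_def vec_eq_iff)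

lemma jac_scaleR:
  "smooth f \<Longrightarrow> vsmooth u \<Longrightarrow> jac (\<lambda>x. f x *\<^sub>R u x) x y = f x *\<^sub>R jac u x y + (grad f x \<bullet> y) *\<^sub>R u x"
  by (simp add: jac_def vec_eq_iff vsmooth_def grad_mult inner_add_left mult.commute)

lemma frechet_derivative_inner_const:
  assumes "vsmooth u"
  shows "frechet_derivative (\<lambda>y. u y \<bullet> c) (at x) v = jac u x v \<bullet> c"
  by (simp add: frechet_derivative_eq_grad[OF smooth_differentiable[OF smooth_inner[OF assms vsmooth_const]]]
      grad_inner[OF assms vsmooth_const] jac_const)

lemma vsmooth_add: "vsmooth u \<Longrightarrow> vsmooth v \<Longrightarrow> vsmooth (\<lambda>x. u x + v x)"
  by (simp add: vsmooth_def smooth_add)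

lemma vsmooth_diff: "vsmooth u \<Longrightarrow> vsmooth v \<Longrightarrow> vsmooth (\<lambda>x. u x - v x)"
  by (simp add: vsmooth_def smooth_diff)

lemma vsmooth_jac: "vsmooth u \<Longrightarrow> vsmooth v \<Longrightarrow> vsmooth (\<lambda>x. jac u x (v x))"
  unfolding vsmooth_def[of "\<lambda>x. jac u x (v x)"] jac_nth by (simp add: smooth_inner vsmooth_grad vsmooth_nth)

lemma vsmooth_continuous_on: "vsmooth u \<Longrightarrow> continuous_on S u"
  by (meson continuous_on_subset has_derivative_continuous_on has_derivative_at_withinI subset_UNIV vsmooth_has_derivative)

section \<open>Differential forms\<close>

lemma fields_alt: "b \<in> fields k \<Longrightarrow> alt_multilinear k (b x)"
  by (simp add: fields_def)

lemma fields_smooth: "b \<in> fields k \<Longrightarrow> smooth (\<lambda>x. b x vs)"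
  by (simp add: fields_def)

lemma fieldsI:
  assumes alt: "\<And>x. alt_multilinear k (b x)"
    and sm: "\<And>vs. length vs = k \<Longrightarrow> smooth (\<lambda>x. b x vs)"
  shows "b \<in> fields k"
proof -
  have "smooth (\<lambda>x. b x vs)" for vs
  proof (cases "length vs = k")
    case False
    then have "(\<lambda>x. b x vs) = (\<lambda>x. 0)" using alt_length[OF alt] by (simp add: fun_eq_iff)
    then show ?thesis by simp
  qed (rule sm)
  then show ?thesis using alt by (simp add: fields_def)
qed

lemma vsmooth_star1: "b \<in> fields 1 \<Longrightarrow> vsmooth (\<lambda>x. star1 (b x))"
  by (simp add: vsmooth_def star1_nth fields_smooth)

lemma vsmooth_star2: "b \<in> fields 2 \<Longrightarrow> vsmooth (\<lambda>x. star2 (b x))"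
  by (simp add: vsmooth_def forall_3 star2_nth fields_smooth)

lemma fields_zero: "(\<lambda>x vs. 0) \<in> fields k"
  by (simp add: fields_def alt_multilinear_def linear_zero)

lemma fields_add: "a \<in> fields k \<Longrightarrow> b \<in> fields k \<Longrightarrow> (\<lambda>x vs. a x vs + b x vs) \<in> fields k"
  by (auto simp: fields_def alt_multilinear_def intro!: smooth_add linear_compose_add)

lemma fields_mult: "smooth f \<Longrightarrow> a \<in> fields k \<Longrightarrow> (\<lambda>x vs. f x * a x vs) \<in> fields k"
  by (auto simp: fields_def alt_multilinear_def linear_iff distrib_left intro!: smooth_mult)

text \<open>
  The 2-form \<open>i(u) (dx\<^sub>1 \<and> dx\<^sub>2 \<and> dx\<^sub>3)\<close> of a vector field \<open>u\<close>.  Every 2-form is of this kind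
  (\<open>fields_2_eq_iota_nu\<close>).
\<close>
definition iota_nu :: "(pt \<Rightarrow> pt) \<Rightarrow> form" where
  "iota_nu u x vs = (if length vs = 2 then u x \<bullet> (vs ! 0 \<times> vs ! 1) else 0)"

lemma iota_nu_fields:
  assumes "vsmooth u" shows "iota_nu u \<in> fields 2"
proof (rule fieldsI)
  fix x show "alt_multilinear 2 (iota_nu u x)"
    unfolding alt_multilinear_2_iff
    by (auto simp: iota_nu_def linear_iff cross_add_left cross_add_right cross_mult_left cross_mult_right
      inner_add_right)
next
  fix vs :: "pt list" assume "length vs = 2"
  then show "smooth (\<lambda>x. iota_nu u x vs)"
    using assms by (auto simp: iota_nu_def intro!: smooth_inner vsmooth_const)
qed

lemma star2_iota_nu: "star2 (iota_nu u x) = u x"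
  by (simp add: vec_eq_iff forall_3 star2_nth iota_nu_def inner3 cross3_nth pd_nth)

lemma fields_2_eq_iota_nu:
  assumes "b \<in> fields 2" shows "b = iota_nu (\<lambda>x. star2 (b x))"
proof (intro ext)
  fix x vs show "b x vs = iota_nu (\<lambda>x. star2 (b x)) x vs"
  proof (cases "length vs = 2")
    case True
    then obtain u v where "vs = [u, v]" by (auto simp: length_Suc_conv numeral_2_eq_2)
    then show ?thesis using alt2_expand[OF fields_alt[OF assms]] by (simp add: iota_nu_def)
  next
    case False
    then show ?thesis using alt_length[OF fields_alt[OF assms]] by (simp add: iota_nu_def)
  qed
qed

lemma ext_deriv_0_form:
  assumes "w \<in> fields 0"
  shows "ext_deriv w x vs = (if length vs = 1 then grad (\<lambda>y. w y []) x \<bullet> vs ! 0 else 0)"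
proof (cases "length vs = 1")
  case True
  then obtain v where vs: "vs = [v]" by (auto simp: length_Suc_conv)
  show ?thesis
    using fields_smooth[OF assms, of "[]"]
    by (simp add: vs ext_deriv_def remove_nth_def frechet_derivative_eq_grad smooth_differentiable)
next
  case False
  have "w y (remove_nth i vs) = 0" if "i < length vs" for i y
    using that False by (intro alt_length[OF fields_alt[OF assms]]) (auto simp: remove_nth_def)
  then show ?thesis using False by (simp add: ext_deriv_def)
qed

section \<open>The coefficient of the Nambu-Poisson structure\<close>

text \<open>The coefficient of \<open>\<Lambda>\<close>: the squared Euclidean norm.\<close>
definition sqn :: "pt \<Rightarrow> real" where
  "sqn x = (x $ 1)\<^sup>2 + (x $ 2)\<^sup>2 + (x $ 3)\<^sup>2"

lemma sqn_eq_0_iff: "sqn x = 0 \<longleftrightarrow> x = 0"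
  by (auto simp: sqn_def vec_eq_iff forall_3 add_nonneg_eq_0_iff)

lemma smooth_sqn [simp, intro]: "smooth sqn"
proof -
  have "smooth (\<lambda>x. x $ 1 * x $ 1 + x $ 2 * x $ 2 + x $ 3 * x $ 3 :: real)" by (intro smooth_add smooth_mult smooth_nth)
  then show ?thesis by (simp add: sqn_def[abs_def] power2_eq_square)
qed

lemma grad_sqn: "grad sqn x = 2 *\<^sub>R x"
proof (rule grad_eqI)
  have "((\<lambda>x::pt. x \<bullet> x) has_derivative (\<lambda>v. 2 *\<^sub>R x \<bullet> v)) (at x)"
    by (auto intro!: derivative_eq_intros simp: inner_commute)
  then show "(sqn has_derivative (\<lambda>v. 2 *\<^sub>R x \<bullet> v)) (at x)"
    by (simp add: sqn_def[abs_def] inner3 power2_eq_square)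
qed

text \<open>
  The equation \<open>dh = h \<theta>\<close> has no smooth solution: on the first axis \<open>\<theta>\<^sub>1\<close> would be \<open>2 / t\<close>.
\<close>
lemma grad_sqn_not_multiple:
  assumes g: "smooth g" and eq: "\<And>x. grad sqn x $ 1 = sqn x * g x"
  shows False
proof -
  have b: "t * (t * g (t *\<^sub>R pd 1)) = t * 2" for t
    using eq[of "t *\<^sub>R pd 1"] by (simp add: grad_sqn sqn_def pd_nth power2_eq_square algebra_simps)
  then have a: "t * g (t *\<^sub>R pd 1) = 2" if "t \<noteq> 0" for t
    using b[of t] that by simp
  have "continuous_on UNIV (\<lambda>t. t * g (t *\<^sub>R pd 1))"
    by (intro continuous_intros continuous_on_compose2[OF smooth_continuous_on[OF g, of UNIV]]) auto
  then have "((\<lambda>t. t * g (t *\<^sub>R pd 1)) \<longlongrightarrow> 0) (at 0)" by (simp add: continuous_on_def) (metis scale_zero_left mult_zero_left)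
  moreover have "((\<lambda>t. t * g (t *\<^sub>R pd 1)) \<longlongrightarrow> 2) (at 0)"
    by (rule tendsto_eventually) (auto simp: eventually_at a intro: exI[of _ 1])
  ultimately show False using tendsto_unique[of "at (0::real)"] by fastforce
qed

section \<open>The trivector field, the volume form and the Nambu identity\<close>

lemma Lambda0_length: "length as \<noteq> 3 \<Longrightarrow> Lambda0 x as = 0"
  by (simp add: Lambda0_def wedge_length)

lemma Lambda0_3: "Lambda0 x [a, b, c] = sqn x * det3 (cov a) (cov b) (cov c)"
  by (simp add: Lambda0_def wedge_3 sqn_def det3_expand cov_nth algebra_simps)

lemma nu0_length: "length as \<noteq> 3 \<Longrightarrow> nu0 x as = 0"
  by (simp add: nu0_def wedge_length)

lemma nu0_3: "nu0 x [u, v, w] = det3 u v w"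
  by (simp add: nu0_def wedge_3 det3_expand dx_apply algebra_simps)

lemma det3_pd:
  "det3 (pd 1) v w = (v \<times> w) $ 1" "det3 (pd 2) v w = (v \<times> w) $ 2" "det3 (pd 3) v w = (v \<times> w) $ 3"
  by (simp_all add: det3_expand cross3_nth pd_nth)

lemma Lambda0_fields: "Lambda0 \<in> fields 3"
proof (rule fieldsI)
  fix x show "alt_multilinear 3 (Lambda0 x)"
    unfolding alt_multilinear_3_iff
    by (auto simp: Lambda0_length Lambda0_3 linear_iff cov_add cov_scaleR det3_expand algebra_simps)
next
  fix as :: "covec list" assume "length as = 3"
  then obtain a b c where "as = [a, b, c]" by (auto simp: length_Suc_conv numeral_3_eq_3)
  then show "smooth (\<lambda>x. Lambda0 x as)" by (simp add: Lambda0_3 smooth_mult)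
qed

lemma nambu_bracket_Lambda0:
  assumes "smooth f" "smooth g" "smooth k"
  shows "nambu_bracket Lambda0 f g k = (\<lambda>x. sqn x * det3 (grad f x) (grad g x) (grad k x))"
  using assms by (simp add: nambu_bracket_def Lambda0_3 cov_diff fun_eq_iff)

text \<open>
  With \<open>X = h (\<nabla>f\<^sub>1 \<times> \<nabla>f\<^sub>2)\<close>, the gradient of \<open>X g\<close> is the transposed Jacobian of \<open>X\<close> applied to \<open>\<nabla>g\<close> plus
  the derivative of \<open>\<nabla>g\<close> along \<open>X\<close>.  The latter terms form the product rule for the determinant, the
  former add up to \<open>div X\<close> times the determinant, and \<open>h div X = X h\<close>.
\<close>
lemma nambu_poisson_Lambda0: "nambu_poisson Lambda0"
  unfolding nambu_poisson_def
proof (intro conjI allI impI)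
  show "Lambda0 \<in> fields 3" by (rule Lambda0_fields)
  fix f1 f2 g1 g2 g3 x
  assume s: "smooth f1" "smooth f2" "smooth g1" "smooth g2" "smooth g3"
  define X where "X = (\<lambda>z. sqn z *\<^sub>R (grad f1 z \<times> grad f2 z))"
  have X: "vsmooth X"
    unfolding X_def by (intro vsmooth_scaleR vsmooth_cross3 vsmooth_grad s smooth_sqn)
  have br: "nambu_bracket Lambda0 f1 f2 g = (\<lambda>z. X z \<bullet> grad g z)" if "smooth g" for g
    unfolding nambu_bracket_Lambda0[OF s(1,2) that] X_def
    by (auto simp: fun_eq_iff det3_expand inner3 cross3_nth algebra_simps)
  have sm: "smooth (nambu_bracket Lambda0 f1 f2 g)" if "smooth g" for g
    unfolding br[OF that] by (intro smooth_inner X vsmooth_grad that)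
  have smg: "smooth (nambu_bracket Lambda0 g1 g2 g3)"
    unfolding nambu_bracket_Lambda0[OF s(3-5)] by (intro smooth_mult smooth_det3 smooth_sqn vsmooth_grad s)
  \<comment> \<open>the transposed Jacobian matrix of \<open>X\<close> at \<open>x\<close>\<close>
  define T where "T = (\<lambda>p. \<chi> j. jac X x (pd j) \<bullet> p)"
  have grad_br: "grad (nambu_bracket Lambda0 f1 f2 g) x = T (grad g x) + jac (grad g) x (X x)" if "smooth g" for g
  proof -
    have "grad (nambu_bracket Lambda0 f1 f2 g) x $ j = (T (grad g x) + jac (grad g) x (X x)) $ j" for j
    proof -
      have "grad (nambu_bracket Lambda0 f1 f2 g) x $ j = grad (nambu_bracket Lambda0 f1 f2 g) x \<bullet> pd j"
        by (simp add: pd_def inner_axis)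
      also have "\<dots> = jac X x (pd j) \<bullet> grad g x + X x \<bullet> jac (grad g) x (pd j)"
        unfolding br[OF that] by (rule grad_inner[OF X vsmooth_grad[OF that]])
      also have "X x \<bullet> jac (grad g) x (pd j) = jac (grad g) x (X x) \<bullet> pd j"
        using jac_grad_symmetric[OF that] by (simp add: inner_commute)
      finally show ?thesis by (simp add: T_def pd_def inner_axis)
    qed
    then show ?thesis by (simp add: vec_eq_iff)
  qed
  have div: "grad sqn x \<bullet> X x = sqn x * divg X x"
    unfolding X_def
    by (simp add: divg_scaleR divg_cross_grad s vsmooth_cross3 vsmooth_grad)
  let ?p = "grad g1 x" and ?q = "grad g2 x" and ?r = "grad g3 x"
  let ?D = "det3 (jac (grad g1) x (X x)) ?q ?r + det3 ?p (jac (grad g2) x (X x)) ?r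
     + det3 ?p ?q (jac (grad g3) x (X x))"
  have tr: "det3 (T ?p) ?q ?r + det3 ?p (T ?q) ?r + det3 ?p ?q (T ?r) = divg X x * det3 ?p ?q ?r"
    by (subst det3_trace[of T "\<lambda>j. jac X x (pd j)"])
      (simp_all add: T_def divg_def jac_nth pd_def inner_axis)
  have "nambu_bracket Lambda0 f1 f2 (nambu_bracket Lambda0 g1 g2 g3) x =
     grad (\<lambda>z. sqn z * det3 (grad g1 z) (grad g2 z) (grad g3 z)) x \<bullet> X x"
    unfolding br[OF smg] by (simp add: nambu_bracket_Lambda0[OF s(3-5)] inner_commute)
  also have "\<dots> = (grad sqn x \<bullet> X x) * det3 ?p ?q ?r + sqn x * ?D"
    by (simp add: grad_mult smooth_det3 vsmooth_grad s inner_add_left grad_det3)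
  also have "\<dots> = sqn x * (det3 (T ?p) ?q ?r + det3 ?p (T ?q) ?r + det3 ?p ?q (T ?r)) + sqn x * ?D"
    unfolding div tr by simp
  also have "\<dots> = sqn x * det3 (T ?p + jac (grad g1) x (X x)) ?q ?r +
     sqn x * det3 ?p (T ?q + jac (grad g2) x (X x)) ?r + sqn x * det3 ?p ?q (T ?r + jac (grad g3) x (X x))"
    by (simp add: det3_def cross_add_left cross_add_right inner_add_left inner_add_right algebra_simps)
  also have "\<dots> = nambu_bracket Lambda0 (nambu_bracket Lambda0 f1 f2 g1) g2 g3 x +
     nambu_bracket Lambda0 g1 (nambu_bracket Lambda0 f1 f2 g2) g3 x +
     nambu_bracket Lambda0 g1 g2 (nambu_bracket Lambda0 f1 f2 g3) x"
    by (simp only: nambu_bracket_Lambda0[OF sm[OF s(3)] s(4,5)] nambu_bracket_Lambda0[OF s(3) sm[OF s(4)] s(5)]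
        nambu_bracket_Lambda0[OF s(3,4) sm[OF s(5)]] grad_br[OF s(3)] grad_br[OF s(4)] grad_br[OF s(5)])
  finally show "nambu_bracket Lambda0 f1 f2 (nambu_bracket Lambda0 g1 g2 g3) x =
     nambu_bracket Lambda0 (nambu_bracket Lambda0 f1 f2 g1) g2 g3 x +
     nambu_bracket Lambda0 g1 (nambu_bracket Lambda0 f1 f2 g2) g3 x +
     nambu_bracket Lambda0 g1 g2 (nambu_bracket Lambda0 f1 f2 g3) x" .
qed

section \<open>The sharp homomorphisms\<close>

text \<open>
  Outside the expected number of arguments the contraction is zero, since \<open>\<Lambda>\<close> is zero on lists of
  length other than \<open>3\<close>.
\<close>
lemma sharp_length: "r \<le> 3 \<Longrightarrow> length as \<noteq> 3 - r \<Longrightarrow> sharp Lambda0 r b x as = 0"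
  unfolding sharp_def contract_def by (rule sum.neutral) (auto simp: Lambda0_length)

lemma sharp_0: "sharp Lambda0 0 b x as = b x [] * Lambda0 x as"
  by (simp add: sharp_def contract_0)

lemma sharp_1: "sharp Lambda0 1 b x [a, c] = sqn x * det3 (star1 (b x)) (cov a) (cov c)"
  unfolding sharp_def contract_1 by (simp add: Lambda0_3 cov_dx star1_nth det3_expand pd_nth algebra_simps)

lemma sharp_2:
  assumes "alt_multilinear 2 (b x)"
  shows "sharp Lambda0 2 b x [a] = sqn x * (star2 (b x) \<bullet> cov a)"
  unfolding sharp_def contract_2
  by (simp add: Lambda0_3 cov_dx det3_pd star2_nth inner3 cross3_nth pd_nth alt2_swap[OF assms, of "pd 3" "pd 2"] algebra_simps)

lemma sharp_3:
  assumes "alt_multilinear 3 (b x)"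
  shows "sharp Lambda0 3 b x [] = sqn x * b x [pd 1, pd 2, pd 3]"
  unfolding sharp_def contract_3
  by (simp add: Lambda0_3 cov_dx det3_pd cross3_nth pd_nth alt3_expand[OF assms, of "pd 3" "pd 1" "pd 2"])

lemma vec_of_sharp_2:
  assumes "alt_multilinear 2 (b x)"
  shows "vec_of (sharp Lambda0 2 b) x = sqn x *\<^sub>R star2 (b x)"
  by (simp add: vec_of_def vec_eq_iff sharp_2[of b, OF assms] cov_dx pd_def inner_axis)

lemma sharp_add: "sharp L r (\<lambda>x vs. a x vs + b x vs) = (\<lambda>x as. sharp L r a x as + sharp L r b x as)"
  by (simp add: sharp_def contract_def fun_eq_iff sum.distrib distrib_right)

lemma sharp_smult: "sharp L r (\<lambda>x vs. f x * a x vs) = (\<lambda>x as. f x * sharp L r a x as)"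
  by (simp add: sharp_def contract_def fun_eq_iff sum_distrib_left mult.assoc)

lemma sharp_fields:
  assumes r: "r \<in> {1, 2, 3}" and b: "b \<in> fields r"
  shows "sharp Lambda0 r b \<in> fields (3 - r)"
proof -
  consider "r = 1" | "r = 2" | "r = 3" using r by auto
  then show ?thesis
  proof cases
    case 1
    have "sharp Lambda0 1 b \<in> fields 2"
    proof (rule fieldsI)
      fix x show "alt_multilinear 2 (sharp Lambda0 1 b x)"
        unfolding alt_multilinear_2_iff
        by (auto simp: sharp_length sharp_1[unfolded One_nat_def] linear_iff cov_add cov_scaleR det3_expand algebra_simps)
    next
      fix as :: "covec list" assume "length as = 2"
      then obtain a c where "as = [a, c]" by (auto simp: length_Suc_conv numeral_2_eq_2)
      then show "smooth (\<lambda>x. sharp Lambda0 1 b x as)"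
        unfolding sharp_1 using b 1
        by (auto simp: sharp_1[unfolded One_nat_def] intro!: smooth_mult smooth_det3 vsmooth_const vsmooth_star1)
    qed
    then show ?thesis using 1 by simp
  next
    case 2
    then have alt: "alt_multilinear 2 (b x)" for x using b by (simp add: fields_alt)
    have "sharp Lambda0 2 b \<in> fields 1"
    proof (rule fieldsI)
      fix x show "alt_multilinear 1 (sharp Lambda0 2 b x)"
        unfolding alt_multilinear_1_iff
        by (auto simp: sharp_length sharp_2[of b, OF alt] linear_iff cov_add cov_scaleR inner_add_right algebra_simps)
    next
      fix as :: "covec list" assume "length as = 1"
      then obtain a where "as = [a]" by (auto simp: length_Suc_conv)
      then show "smooth (\<lambda>x. sharp Lambda0 2 b x as)"
        using b 2 by (auto simp: sharp_2[of b, OF alt] intro!: smooth_mult smooth_inner vsmooth_const vsmooth_star2)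
    qed
    then show ?thesis using 2 by simp
  next
    case 3
    then have alt: "alt_multilinear 3 (b x)" for x using b by (simp add: fields_alt)
    have "sharp Lambda0 3 b \<in> fields 0"
    proof (rule fieldsI)
      fix x show "alt_multilinear 0 (sharp Lambda0 3 b x)"
        unfolding alt_multilinear_0_iff by (auto simp: sharp_length)
    next
      fix as :: "covec list" assume "length as = 0"
      then show "smooth (\<lambda>x. sharp Lambda0 3 b x as)"
        using fields_smooth[OF b] by (auto simp: sharp_3[of b, OF alt] intro!: smooth_mult)
    qed
    then show ?thesis using 3 by simp
  qed
qed

lemma sharp_inj_on:
  assumes r: "r \<in> {1, 2, 3}"
  shows "inj_on (sharp Lambda0 r) (fields r)"
proof (rule inj_onI)
  fix b b' assume b: "b \<in> fields r" "b' \<in> fields r" and eq: "sharp Lambda0 r b = sharp Lambda0 r b'"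
  have alt: "alt_multilinear r (b x)" "alt_multilinear r (b' x)" for x using b by (simp_all add: fields_alt)
  have off0: "b x vs = b' x vs" if x: "x \<noteq> 0" for x vs
  proof (cases "length vs = r")
    case False then show ?thesis using alt_length alt by metis
  next
    case True
    have s: "sqn x \<noteq> 0" using x by (simp add: sqn_eq_0_iff)
    consider "r = 1" | "r = 2" | "r = 3" using r by auto
    then show ?thesis
    proof cases
      case 1
      have e: "det3 (star1 (b x)) (cov a) (cov c) = det3 (star1 (b' x)) (cov a) (cov c)" for a c
        using arg_cong[OF eq, of "\<lambda>P. P x [a, c]"] s unfolding 1 sharp_1 by simp
      have "star1 (b x) = star1 (b' x)"
        using e[of "dx 2" "dx 3"] e[of "dx 3" "dx 1"] e[of "dx 1" "dx 2"]
        by (simp add: cov_dx det3_expand pd_nth vec_eq_iff forall_3)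
      moreover obtain v where "vs = [v]" using True 1 by (auto simp: length_Suc_conv)
      ultimately show ?thesis using alt alt1_expand 1 by metis
    next
      case 2
      have e: "star2 (b x) \<bullet> cov a = star2 (b' x) \<bullet> cov a" for a
        using arg_cong[OF eq, of "\<lambda>P. P x [a]"] s sharp_2[of b x] sharp_2[of b' x] alt 2 by simp
      have "star2 (b x) = star2 (b' x)"
        using e[of "dx 1"] e[of "dx 2"] e[of "dx 3"]
        by (simp add: cov_dx inner3 pd_nth vec_eq_iff forall_3)
      moreover obtain u v where "vs = [u, v]" using True 2 by (auto simp: length_Suc_conv numeral_2_eq_2)
      ultimately show ?thesis using alt alt2_expand 2 by metis
    next
      case 3
      have "b x [pd 1, pd 2, pd 3] = b' x [pd 1, pd 2, pd 3]"
        using arg_cong[OF eq, of "\<lambda>P. P x []"] s sharp_3[of b x] sharp_3[of b' x] alt 3 by simp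
      moreover obtain u v w where "vs = [u, v, w]" using True 3 by (auto simp: length_Suc_conv numeral_3_eq_3)
      ultimately show ?thesis using alt alt3_expand 3 by metis
    qed
  qed
  show "b = b'"
  proof (intro ext)
    fix x vs show "b x vs = b' x vs"
      using smooth_eq_off_origin[of "\<lambda>x. b x vs" "\<lambda>x. b' x vs" x] off0 b fields_smooth by blast
  qed
qed

lemma sharp_mod_mono:
  assumes "r \<in> {1, 2, 3}"
  shows "sharp Lambda0 r \<in> mod_mono {f. smooth f} (Omega r) (Mvf (3 - r))"
  using sharp_inj_on[OF assms] sharp_fields[OF assms]
  by (auto simp: mod_mono_def mod_hom_def field_module_def sharp_add sharp_smult)

section \<open>The modular bivector and the boundary operator\<close>

text \<open>
  The bivector field \<open>i(dh) (\<partial>\<^sub>1 \<and> \<partial>\<^sub>2 \<and> \<partial>\<^sub>3)\<close>; the modular bivector turns out to be this one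
  (\<open>modular_bivector_eq\<close>).
\<close>
definition grad_bivector :: mvfield where
  "grad_bivector x as = (if length as = 2 then det3 (grad sqn x) (cov (as ! 0)) (cov (as ! 1)) else 0)"

lemma grad_bivector_fields: "grad_bivector \<in> fields 2"
proof (rule fieldsI)
  fix x show "alt_multilinear 2 (grad_bivector x)"
    unfolding alt_multilinear_2_iff grad_bivector_def
    by (auto simp: linear_iff cov_add cov_scaleR det3_expand algebra_simps)
next
  fix as :: "covec list" assume "length as = 2"
  then show "smooth (\<lambda>x. grad_bivector x as)"
    by (auto simp: grad_bivector_def intro!: smooth_det3 vsmooth_const vsmooth_grad)
qed

lemma lie_deriv_nu0:
  assumes "vsmooth X" shows "lie_deriv X nu0 x vs = divg X x * nu0 x vs"
proof (cases "length vs = 3")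
  case False
  then show ?thesis by (simp add: lie_deriv_def nu0_length)
next
  case True
  then obtain u v w where vs: "vs = [u, v, w]" by (auto simp: length_Suc_conv numeral_3_eq_3)
  have "lie_deriv X nu0 x vs = det3 (jac X x u) v w + det3 u (jac X x v) w + det3 u v (jac X x w)"
    unfolding lie_deriv_def frechet_derivative_eq_jac[OF assms] vs
    by (simp add: nu0_3 lessThan_Suc)
  also have "\<dots> = divg X x * det3 u v w"
    by (subst det3_trace[of "jac X x" "\<lambda>i. grad (\<lambda>z. X z $ i) x"]) (simp_all add: jac_def divg_def)
  finally show ?thesis by (simp add: vs nu0_3)
qed

lemma div_vol_nu0:
  assumes "vsmooth X" shows "div_vol nu0 X = divg X"
  unfolding div_vol_def
proof (rule the_equality)
  show "\<forall>x vs. lie_deriv X nu0 x vs = divg X x * nu0 x vs" by (simp add: lie_deriv_nu0 assms)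
next
  fix f assume f: "\<forall>x vs. lie_deriv X nu0 x vs = f x * nu0 x vs"
  show "f = divg X"
  proof
    fix x
    have "nu0 x [pd 1, pd 2, pd 3] = 1" by (simp add: nu0_3 det3_expand pd_nth)
    then show "f x = divg X x"
      using f[rule_format, of x "[pd 1, pd 2, pd 3]"] lie_deriv_nu0[OF assms, of x "[pd 1, pd 2, pd 3]"] by simp
  qed
qed

lemma alt_wedge_2:
  assumes "linear f" "linear g" shows "alt_multilinear 2 (wedge [f, g])"
  using assms unfolding alt_multilinear_2_iff
  by (auto simp: wedge_length wedge_2 linear_iff algebra_simps)

lemma vec_of_hamiltonian:
  assumes "smooth f" "smooth g"
  shows "vec_of (hamiltonian Lambda0 f g) = (\<lambda>x. sqn x *\<^sub>R (grad f x \<times> grad g x))"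
proof
  fix x
  have "alt_multilinear 2 (wedge [blinfun_apply (diff f x), blinfun_apply (diff g x)])"
    by (intro alt_wedge_2 bounded_linear.linear blinfun.bounded_linear_right)
  then have "vec_of (hamiltonian Lambda0 f g) x =
      sqn x *\<^sub>R star2 (wedge [blinfun_apply (diff f x), blinfun_apply (diff g x)])"
    unfolding hamiltonian_def by (rule vec_of_sharp_2)
  also have "star2 (wedge [blinfun_apply (diff f x), blinfun_apply (diff g x)]) = grad f x \<times> grad g x"
    by (simp add: vec_eq_iff forall_3 star2_nth cross3_nth wedge_2 cov_diff[OF assms(1), symmetric]
        cov_diff[OF assms(2), symmetric] cov_nth)
  finally show "vec_of (hamiltonian Lambda0 f g) x = sqn x *\<^sub>R (grad f x \<times> grad g x)" .
qed

lemma div_hamiltonian: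
  assumes "smooth f" "smooth g"
  shows "div_vol nu0 (vec_of (hamiltonian Lambda0 f g)) x = det3 (grad sqn x) (grad f x) (grad g x)"
proof -
  have X: "vsmooth (\<lambda>x. grad f x \<times> grad g x)" by (intro vsmooth_cross3 vsmooth_grad assms)
  show ?thesis
    unfolding vec_of_hamiltonian[OF assms] div_vol_nu0[OF vsmooth_scaleR[OF smooth_sqn X]]
    by (simp add: divg_scaleR X divg_cross_grad assms det3_def)
qed

text \<open>
  Uniqueness holds because every pair of covectors at a point is the pair of differentials of two
  linear functions.
\<close>
lemma modular_bivector_eq: "modular_bivector Lambda0 nu0 = grad_bivector"
  unfolding modular_bivector_def
proof (rule the_equality)
  show "grad_bivector \<in> fields 2 \<and> (\<forall>f g. smooth f \<longrightarrow> smooth g \<longrightarrow>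
           (\<forall>x. grad_bivector x [diff f x, diff g x] = div_vol nu0 (vec_of (hamiltonian Lambda0 f g)) x))"
    by (simp add: grad_bivector_fields div_hamiltonian grad_bivector_def cov_diff)
next
  fix P assume P: "P \<in> fields 2 \<and> (\<forall>f g. smooth f \<longrightarrow> smooth g \<longrightarrow>
           (\<forall>x. P x [diff f x, diff g x] = div_vol nu0 (vec_of (hamiltonian Lambda0 f g)) x))"
  show "P = grad_bivector"
  proof (intro ext)
    fix x as show "P x as = grad_bivector x as"
    proof (cases "length as = 2")
      case False
      then show ?thesis using P alt_length[OF fields_alt[of P 2 x]] by (simp add: grad_bivector_def)
    next
      case True
      then obtain a b where as: "as = [a, b]" by (auto simp: length_Suc_conv numeral_2_eq_2)
      obtain f g where f: "smooth f" "\<forall>x. diff f x = a" and g: "smooth g" "\<forall>x. diff g x = b"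
        using exists_linear_diff by metis
      have "P x [diff f x, diff g x] = det3 (grad sqn x) (cov (diff f x)) (cov (diff g x))"
        using P[THEN conjunct2, rule_format, OF f(1) g(1)] div_hamiltonian[OF f(1) g(1)]
        by (simp add: cov_diff f(1) g(1))
      then show ?thesis
        using f(2) g(2) by (simp add: as grad_bivector_def)
    qed
  qed
qed

lemma grad_bivector_not_sharp: "grad_bivector \<notin> sharp Lambda0 1 ` fields 1"
proof
  assume "grad_bivector \<in> sharp Lambda0 1 ` fields 1"
  then obtain b where b: "b \<in> fields 1" and eq: "grad_bivector = sharp Lambda0 1 b" by blast
  show False
  proof (rule grad_sqn_not_multiple)
    show "smooth (\<lambda>x. b x [pd 1])" using b by (rule fields_smooth)
    fix x
    have "grad_bivector x [dx 2, dx 3] = sharp Lambda0 1 b x [dx 2, dx 3]" by (simp add: eq)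
    then show "grad sqn x $ 1 = sqn x * b x [pd 1]"
      unfolding sharp_1 by (simp add: grad_bivector_def cov_dx det3_expand pd_nth star1_nth)
  qed
qed

lemma flat_3_Lambda0: "flat nu0 3 Lambda0 x vs = (if vs = [] then sqn x else 0)"
  unfolding flat_def contract_3
  by (auto simp: Lambda0_3 cov_dx nu0_3 nu0_length det3_expand pd_nth)

lemma flat_2_length: "length vs \<noteq> 1 \<Longrightarrow> flat nu0 2 P x vs = 0"
  unfolding flat_def contract_2 by (simp add: nu0_length)

lemma flat_2:
  assumes "alt_multilinear 2 (P x)"
  shows "flat nu0 2 P x [u] =
    P x [dx 2, dx 3] * u $ 1 + P x [dx 3, dx 1] * u $ 2 + P x [dx 1, dx 2] * u $ 3"
  unfolding flat_def contract_2
  by (simp add: nu0_3 det3_expand pd_nth alt2_swap[OF assms, of "dx 3" "dx 2"])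

text \<open>
  The map \<open>flat nu0 2\<close> sends both \<open>boundary nu0 3 Lambda0\<close> and the modular bivector to \<open>dh\<close>, and sends
  \<open>sharp Lambda0 1 b\<close> to \<open>h b\<close>.
\<close>
lemma boundary_Lambda0:
  "boundary nu0 3 Lambda0 \<notin> sharp Lambda0 1 ` fields 1"
proof
  assume "boundary nu0 3 Lambda0 \<in> sharp Lambda0 1 ` fields 1"
  then obtain b where b: "b \<in> fields 1" and eq: "boundary nu0 3 Lambda0 = sharp Lambda0 1 b" by blast
  have "flat nu0 3 Lambda0 \<in> fields 0"
    by (rule fieldsI) (auto simp: alt_multilinear_0_iff flat_3_Lambda0)
  from ext_deriv_0_form[OF this]
  have d: "ext_deriv (flat nu0 3 Lambda0) x vs = (if length vs = 1 then grad sqn x \<bullet> vs ! 0 else 0)" for x vs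
    by (simp add: flat_3_Lambda0)
  have "ext_deriv (flat nu0 3 Lambda0) x vs = flat nu0 2 grad_bivector x vs" for x vs
  proof (cases "length vs = 1")
    case False then show ?thesis unfolding d by (simp add: flat_2_length)
  next
    case True
    then obtain u where "vs = [u]" by (auto simp: length_Suc_conv)
    then show ?thesis unfolding d
      by (simp add: flat_2[OF fields_alt[OF grad_bivector_fields]] inner3 grad_bivector_def cov_dx det3_expand pd_nth)
  qed
  then have "ext_deriv (flat nu0 3 Lambda0) \<in> flat nu0 2 ` fields 2"
    using grad_bivector_fields by (blast intro: image_eqI[where x = grad_bivector])
  then have fb: "flat nu0 2 (sharp Lambda0 1 b) = ext_deriv (flat nu0 3 Lambda0)"
    unfolding eq[symmetric] boundary_def by (simp add: f_inv_into_f)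
  have alt: "alt_multilinear 2 (sharp Lambda0 1 b x)" for x
    using fields_alt[OF sharp_fields[OF _ b], of x] by simp
  show False
  proof (rule grad_sqn_not_multiple)
    show "smooth (\<lambda>x. b x [pd 1])" using b by (rule fields_smooth)
    fix x
    have "flat nu0 2 (sharp Lambda0 1 b) x [pd 1] = grad sqn x \<bullet> pd 1"
      unfolding fb d by simp
    then show "grad sqn x $ 1 = sqn x * b x [pd 1]"
      unfolding flat_2[of "sharp Lambda0 1 b", OF alt] sharp_1
      by (simp add: inner3 pd_nth cov_dx det3_expand star1_nth)
  qed
qed

lemma not_subcomplex: "\<not> is_subcomplex nu0 (sharp_image Lambda0)"
proof
  assume "is_subcomplex nu0 (sharp_image Lambda0)"
  then have "boundary nu0 3 ` sharp_image Lambda0 3 \<subseteq> sharp_image Lambda0 2"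
    unfolding is_subcomplex_def by (auto dest!: conjunct2 bspec[where x = 3])
  moreover have "Lambda0 \<in> sharp_image Lambda0 3"
  proof -
    define w :: form where "w = (\<lambda>x vs. if vs = [] then 1 else 0)"
    have "w \<in> fields 0" by (rule fieldsI) (auto simp: alt_multilinear_0_iff w_def)
    moreover have "sharp Lambda0 0 w = Lambda0" by (simp add: fun_eq_iff sharp_0 w_def)
    ultimately show ?thesis unfolding sharp_image_def by (auto intro!: image_eqI[where x = w])
  qed
  ultimately show False using boundary_Lambda0 by (auto simp: sharp_image_def)
qed

section \<open>The Poincare lemma for 1-forms\<close>

text \<open>A closed 1-form, regarded as a vector field, has a symmetric Jacobian matrix.\<close>
lemma ext_deriv_closed_1_form_symmetric:
  assumes a: "a \<in> fields 1" and c: "ext_deriv a = (\<lambda>x vs. 0)"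
  shows "jac (\<lambda>x. star1 (a x)) x u \<bullet> v = jac (\<lambda>x. star1 (a x)) x v \<bullet> u"
proof -
  have s: "vsmooth (\<lambda>x. star1 (a x))" using a by (rule vsmooth_star1)
  have e: "(\<lambda>y. a y [w]) = (\<lambda>y. star1 (a y) \<bullet> w)" for w
    using alt1_expand[OF fields_alt[OF a]] by (rule ext)
  have f: "frechet_derivative (\<lambda>y. star1 (a y) \<bullet> w) (at x) z = jac (\<lambda>x. star1 (a x)) x z \<bullet> w" for w z
    by (simp add: frechet_derivative_eq_grad[OF smooth_differentiable[OF smooth_inner[OF s vsmooth_const]]]
        grad_inner[OF s vsmooth_const] jac_const)
  have "ext_deriv a x [u, v] = 0" by (simp add: c)
  then show ?thesis
    by (simp add: ext_deriv_def remove_nth_def lessThan_Suc e f)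
qed

text \<open>
  The primitive is \<open>f x = \<integral>\<^sub>0\<^sup>1 u (t x) \<bullet> x dt\<close>.  By symmetry of the Jacobian the gradient of the integrand is
  \<open>w x t = t (u'(t x) x) + u (t x)\<close>, which is the derivative of \<open>t u (t x)\<close> in \<open>t\<close>.
\<close>
lemma symmetric_jac_imp_gradient:
  assumes u: "vsmooth u" and sym: "\<And>x a b. jac u x a \<bullet> b = jac u x b \<bullet> a"
  obtains f where "smooth f" "grad f = u"
proof -
  define w where "w = (\<lambda>x t. t *\<^sub>R jac u (t *\<^sub>R x) x + u (t *\<^sub>R x))"
  define f where "f = (\<lambda>x. integral (cbox 0 (1::real)) (\<lambda>t. u (t *\<^sub>R x) \<bullet> x))"
  have cu: "continuous_on S (\<lambda>z. u (g z))" if "continuous_on S g" for S :: "'c::topological_space set" and g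
    using continuous_on_compose2[OF vsmooth_continuous_on[OF u, of UNIV] that] by simp
  have cj: "continuous_on S (\<lambda>z. jac u (g z) (k z))" if "continuous_on S g" "continuous_on S k"
    for S :: "'c::topological_space set" and g k
    unfolding jac_def
  proof (intro continuous_on_vec_lambda continuous_on_inner that)
    fix i
    show "continuous_on S (\<lambda>z. grad (\<lambda>y. u y $ i) (g z))"
      using continuous_on_compose2[OF vsmooth_continuous_on[OF vsmooth_grad[OF vsmooth_nth[OF u]], of UNIV] that(1)] by simp
  qed
  have cw: "continuous_on UNIV (\<lambda>z. w (fst z) (snd z))"
    unfolding w_def by (intro continuous_intros cu cj)
  have d: "((\<lambda>x. u (t *\<^sub>R x) \<bullet> x) has_derivative blinfun_apply (blinfun_inner_right (w x t))) (at x)" for x t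
  proof -
    have "((\<lambda>x. u (t *\<^sub>R x)) has_derivative (\<lambda>v. jac u (t *\<^sub>R x) (t *\<^sub>R v))) (at x)"
      by (rule has_derivative_compose[OF _ vsmooth_has_derivative[OF u]]) (auto intro!: derivative_eq_intros)
    from has_derivative_inner[OF this has_derivative_ident]
    have "((\<lambda>x. u (t *\<^sub>R x) \<bullet> x) has_derivative (\<lambda>v. u (t *\<^sub>R x) \<bullet> v + jac u (t *\<^sub>R x) (t *\<^sub>R v) \<bullet> x)) (at x)" .
    moreover have "u (t *\<^sub>R x) \<bullet> v + jac u (t *\<^sub>R x) (t *\<^sub>R v) \<bullet> x = w x t \<bullet> v" for v
      using sym[of "t *\<^sub>R x" "t *\<^sub>R v" x] by (simp add: w_def inner_add_left)
    ultimately show ?thesis by simp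
  qed
  have "(f has_derivative integral (cbox 0 1) (\<lambda>t. blinfun_inner_right (w x t))) (at x)" for x
    unfolding f_def
  proof (rule leibniz_rule[where U = UNIV and fx = "\<lambda>x t. blinfun_inner_right (w x t)"])
    show "(\<lambda>t. u (t *\<^sub>R x) \<bullet> x) integrable_on cbox 0 1" for x
      by (intro integrable_continuous continuous_intros cu)
    show "continuous_on (SIGMA x:UNIV. cbox 0 1) (\<lambda>(x, t). blinfun_inner_right (w x t))"
      unfolding split_beta
      by (intro bounded_linear.continuous_on[OF bounded_linear_blinfun_inner_right] continuous_on_subset[OF cw]) auto
  qed (auto simp: d[simplified])
  moreover have "integral (cbox 0 1) (\<lambda>t. blinfun_inner_right (w x t)) = blinfun_inner_right (u x)" for x
  proof -
    have "((\<lambda>t. t *\<^sub>R u (t *\<^sub>R x)) has_vector_derivative w x t) (at t within {0..1})" for t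
    proof -
      have "((\<lambda>t. u (t *\<^sub>R x)) has_derivative (\<lambda>s. jac u (t *\<^sub>R x) (s *\<^sub>R x))) (at t within {0..1})"
        by (rule has_derivative_compose[OF _ vsmooth_has_derivative[OF u]]) (auto intro!: derivative_eq_intros)
      from has_derivative_scaleR[OF has_derivative_ident this]
      have "((\<lambda>t. t *\<^sub>R u (t *\<^sub>R x)) has_derivative (\<lambda>s. t *\<^sub>R jac u (t *\<^sub>R x) (s *\<^sub>R x) + s *\<^sub>R u (t *\<^sub>R x))) (at t within {0..1})" .
      moreover have "t *\<^sub>R jac u (t *\<^sub>R x) (s *\<^sub>R x) + s *\<^sub>R u (t *\<^sub>R x) = s *\<^sub>R w x t" for s
        by (simp add: w_def jac_def vec_eq_iff algebra_simps)
      ultimately show ?thesis by (simp add: has_vector_derivative_def)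
    qed
    from fundamental_theorem_of_calculus[OF zero_le_one, of _ "w x", OF this]
    have "(w x has_integral u x) (cbox 0 1)" by simp
    from has_integral_linear[OF this bounded_linear_blinfun_inner_right]
    show ?thesis unfolding o_def by (rule integral_unique)
  qed
  ultimately have df: "(f has_derivative (\<lambda>v. u x \<bullet> v)) (at x)" for x by simp
  then have g: "grad f = u" by (intro ext grad_eqI)
  have "f differentiable at x" for x using df differentiable_def by blast
  moreover from this have "frechet_derivative f (at x) v = u x \<bullet> v" for x v
    by (simp add: frechet_derivative_eq_grad g)
  ultimately have "smooth f"
    by - (rule smoothI, simp_all add: smooth_inner u vsmooth_const)
  then show ?thesis using g by (rule that)
qed

lemma poincare_1_forms:
  assumes a: "a \<in> fields 1" and c: "ext_deriv a = (\<lambda>x vs. 0)"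
  shows "a \<in> ext_deriv ` fields 0"
proof -
  obtain f where f: "smooth f" and g: "grad f = (\<lambda>x. star1 (a x))"
    using symmetric_jac_imp_gradient[OF vsmooth_star1[OF a] ext_deriv_closed_1_form_symmetric[OF a c]] .
  define w :: form where "w = (\<lambda>x vs. if vs = [] then f x else 0)"
  have w: "w \<in> fields 0" by (rule fieldsI) (auto simp: w_def f alt_multilinear_0_iff)
  have wg: "grad (\<lambda>y. w y []) x = star1 (a x)" for x by (simp add: w_def g)
  have "a x vs = ext_deriv w x vs" for x vs
  proof (cases "length vs = 1")
    case True
    then obtain v where "vs = [v]" by (auto simp: length_Suc_conv)
    then show ?thesis using alt1_expand[OF fields_alt[OF a]] by (simp add: ext_deriv_0_form[OF w] wg)
  next
    case False
    then show ?thesis using alt_length[OF fields_alt[OF a]] by (simp add: ext_deriv_0_form[OF w])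
  qed
  then have "a = ext_deriv w" by (intro ext)
  then show ?thesis using w by blast
qed

section \<open>Foliated cohomology\<close>

lemmas coset_defs = a_r_coset_def' A_RCOSETS_def' set_add_def'

lemma quot_zero_singletons:
  "carrier (quot_module (Omega k) {\<lambda>x vs. 0}) = (\<lambda>a. {a}) ` fields k"
  "\<zero>\<^bsub>quot_module (Omega k) {\<lambda>x vs. 0}\<^esub> = {\<lambda>x vs. 0}"
  "{a} \<oplus>\<^bsub>quot_module (Omega k) {\<lambda>x vs. 0}\<^esub> {b} = {\<lambda>x vs. a x vs + b x vs}"
  "f \<odot>\<^bsub>quot_module (Omega k) {\<lambda>x vs. 0}\<^esub> {a} = {\<lambda>x vs. f x * a x vs}"
  by (auto simp: quot_module_def field_module_def coset_defs)

text \<open>Off the origin the characteristic foliation is the whole tangent space.\<close>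
lemma sharp_2_onto:
  assumes "x \<noteq> 0"
  obtains b where "b \<in> fields 2" "vec_of (sharp Lambda0 2 b) x = v"
proof -
  let ?b = "iota_nu (\<lambda>_. inverse (sqn x) *\<^sub>R v)"
  have b: "?b \<in> fields 2" by (intro iota_nu_fields vsmooth_const)
  then have "vec_of (sharp Lambda0 2 ?b) x = v"
    using assms by (simp add: vec_of_sharp_2 fields_alt star2_iota_nu sqn_eq_0_iff)
  then show ?thesis using b that by blast
qed

text \<open>
  Off the origin all tangent vectors are tangent to the foliation, so a form vanishing along the
  foliation vanishes there, and by continuity also at the origin.
\<close>
lemma leaf_null_forms_Lambda0: "leaf_null_forms Lambda0 k = {\<lambda>x vs. 0}"
proof (intro equalityI subsetI)
  fix a assume "a \<in> leaf_null_forms Lambda0 k"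
  then have a: "a \<in> fields k" and
    n: "\<And>Xs x. length Xs = k \<Longrightarrow> set Xs \<subseteq> (\<lambda>b. vec_of (sharp Lambda0 2 b)) ` fields 2 \<Longrightarrow>
         a x (map (\<lambda>X. X x) Xs) = 0"
    by (auto simp: leaf_null_forms_def)
  have "a x vs = 0" if x: "x \<noteq> 0" for x vs
  proof (cases "length vs = k")
    case True
    have "\<forall>v. \<exists>X \<in> (\<lambda>b. vec_of (sharp Lambda0 2 b)) ` fields 2. X x = v"
      using sharp_2_onto[OF x] by (metis image_eqI)
    then obtain X where X: "\<And>v. X v \<in> (\<lambda>b. vec_of (sharp Lambda0 2 b)) ` fields 2" "\<And>v. X v x = v"
      by metis
    have "a x (map (\<lambda>X. X x) (map X vs)) = 0"
      using X(1) True by (intro n) auto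
    then show ?thesis by (simp add: X(2) o_def)
  qed (use alt_length[OF fields_alt[OF a]] in auto)
  then have "a x vs = 0" for x vs
    using smooth_eq_off_origin[OF fields_smooth[OF a] smooth_const, of vs 0 x] by blast
  then show "a \<in> {\<lambda>x vs. 0}" by (simp add: fun_eq_iff)
qed (auto simp: leaf_null_forms_def fields_zero)

lemma foliated_forms_singletons:
  "carrier (foliated_forms Lambda0 k) = (\<lambda>a. {a}) ` fields k"
  "\<zero>\<^bsub>foliated_forms Lambda0 k\<^esub> = {\<lambda>x vs. 0}"
  "{a} \<oplus>\<^bsub>foliated_forms Lambda0 k\<^esub> {b} = {\<lambda>x vs. a x vs + b x vs}"
  "f \<odot>\<^bsub>foliated_forms Lambda0 k\<^esub> {a} = {\<lambda>x vs. f x * a x vs}"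
  by (simp_all only: foliated_forms_def leaf_null_forms_Lambda0 quot_zero_singletons)

lemma foliated_deriv_singleton: "foliated_deriv Lambda0 k {a} = {ext_deriv a}"
  by (simp add: foliated_deriv_def leaf_null_forms_Lambda0 coset_defs field_module_def)

lemma real_scalars_simps [simp]:
  "carrier (real_scalars V) = carrier V" "zero (real_scalars V) = zero V" "add (real_scalars V) = add V"
  "smult (real_scalars V) = (\<lambda>a. smult V (\<lambda>_. a))"
  by (simp_all add: real_scalars_def)

text \<open>
  If \<open>W\<close> is the copy of \<open>V\<close> consisting of singletons, then a coset in \<open>W\<close> is the set of singletons of a
  coset in \<open>V\<close>, and the union operator gives the isomorphism of quotients.
\<close>
lemma quot_module_iso:
  fixes V :: "(real, 'b) module" and W :: "(real, 'b set) module"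
  assumes car: "carrier W = (\<lambda>a. {a}) ` carrier V"
    and add: "\<And>a b. add W {a} {b} = {add V a b}"
    and smult: "\<And>c a. smult W c {a} = {smult V c a}"
  shows "vs_isomorphic (quot_module W ((\<lambda>a. {a}) ` N)) (quot_module V N)"
proof -
  let ?s = "\<lambda>a. {a}"
  have r: "a_r_coset W (?s ` N) {a} = ?s ` a_r_coset V N a" for a
    by (auto simp: a_r_coset_def' add)
  have Un: "\<Union> (?s ` X) = X" for X by auto
  have sa: "add (quot_module W (?s ` N)) (?s ` X) (?s ` Y) = ?s ` add (quot_module V N) X Y" for X Y
    by (auto simp: quot_module_def set_add_def' add)
  have sm: "smult (quot_module W (?s ` N)) c (?s ` X) = ?s ` smult (quot_module V N) c X" for c X
    by (simp add: quot_module_def smult r image_UN)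
  have cq: "carrier (quot_module W (?s ` N)) = (`) ?s ` carrier (quot_module V N)"
    by (auto simp: quot_module_def A_RCOSETS_def' car r)
  have "Union \<in> mod_hom UNIV (quot_module W (?s ` N)) (quot_module V N)"
    unfolding mod_hom_def
    by (auto simp: cq sa sm Un)
  moreover have "bij_betw Union (carrier (quot_module W (?s ` N))) (carrier (quot_module V N))"
    by (rule bij_betw_byWitness[where f' = "(`) ?s"]) (auto simp: cq Un)
  ultimately show ?thesis by (auto simp: vs_isomorphic_def)
qed

lemma foliated_iso_deRham: "vs_isomorphic (foliated_cohomology Lambda0 k) (deRham k)"
proof -
  let ?s = "\<lambda>a :: form. {a}"
  let ?N = "case k of 0 \<Rightarrow> {\<zero>\<^bsub>Omega 0\<^esub>} | Suc j \<Rightarrow> ext_deriv ` carrier (Omega j)"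
  have N: "(case k of 0 \<Rightarrow> {\<zero>\<^bsub>foliated_forms Lambda0 0\<^esub>}
      | Suc j \<Rightarrow> foliated_deriv Lambda0 j ` carrier (foliated_forms Lambda0 j)) = ?s ` ?N"
    by (auto simp: foliated_forms_singletons foliated_deriv_singleton field_module_def image_image split: nat.split)
  show ?thesis
    unfolding foliated_cohomology_def deRham_def cohomology_def N
    by (rule quot_module_iso)
      (auto simp: foliated_forms_singletons foliated_deriv_singleton field_module_def)
qed

lemma ext_deriv_0_form_add:
  assumes a: "a \<in> fields 0" and b: "b \<in> fields 0"
  shows "(\<lambda>x vs. a x vs + c * b x vs) \<in> fields 0" (is "?w \<in> _")
    and "ext_deriv (\<lambda>x vs. a x vs + c * b x vs) = (\<lambda>x vs. ext_deriv a x vs + c * ext_deriv b x vs)"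
proof -
  show w: "?w \<in> fields 0"
    using a b by (auto simp: fields_def alt_multilinear_0_iff intro!: smooth_add smooth_mult)
  have s: "smooth (\<lambda>x. a x [])" "smooth (\<lambda>x. b x [])" using a b by (auto simp: fields_smooth)
  show "ext_deriv ?w = (\<lambda>x vs. ext_deriv a x vs + c * ext_deriv b x vs)"
    using s by (auto simp: fun_eq_iff ext_deriv_0_form[OF w] ext_deriv_0_form[OF a] ext_deriv_0_form[OF b]
      grad_add grad_mult smooth_mult inner_add_left)
qed

lemma foliated_cohomology_1_trivial:
  "carrier (foliated_cohomology Lambda0 1) = {\<zero>\<^bsub>foliated_cohomology Lambda0 1\<^esub>}"
proof -
  let ?s = "\<lambda>a :: form. {a}"
  \<comment> \<open>closed and exact 1-forms\<close>
  define Z where "Z = {z \<in> fields 1. ext_deriv z = (\<lambda>x vs. 0)}"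
  define B :: "form set" where "B = ext_deriv ` fields 0"
  \<comment> \<open>a coset of the exact forms by an exact form is the set of exact forms\<close>
  have coset: "(\<lambda>y x vs. y x vs + z x vs) ` B = B" if zB: "z \<in> B" for z
  proof (intro equalityI subsetI)
    obtain b where b: "b \<in> fields 0" and z: "z = ext_deriv b" using zB by (auto simp: B_def)
    fix y
    show "y \<in> B" if y: "y \<in> (\<lambda>y x vs. y x vs + z x vs) ` B"
    proof -
      obtain a where "a \<in> fields 0" "y = (\<lambda>x vs. ext_deriv a x vs + z x vs)"
        using y by (auto simp: B_def)
      then have "y = ext_deriv (\<lambda>x vs. a x vs + 1 * b x vs)" "(\<lambda>x vs. a x vs + 1 * b x vs) \<in> fields 0"
        using ext_deriv_0_form_add[of a b 1] b by (simp_all add: z)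
      then show ?thesis unfolding B_def by (rule image_eqI)
    qed
    show "y \<in> (\<lambda>y x vs. y x vs + z x vs) ` B" if y: "y \<in> B"
    proof -
      obtain a where a: "a \<in> fields 0" "y = ext_deriv a" using y by (auto simp: B_def)
      then have "(\<lambda>x vs. y x vs - z x vs) = ext_deriv (\<lambda>x vs. a x vs + (-1) * b x vs)"
        "(\<lambda>x vs. a x vs + (-1) * b x vs) \<in> fields 0"
        using ext_deriv_0_form_add[of a b "-1"] b by (simp_all add: z)
      then have "(\<lambda>x vs. y x vs - z x vs) \<in> B" unfolding B_def by (rule image_eqI)
      then show ?thesis by (intro image_eqI[where x = "\<lambda>x vs. y x vs - z x vs"]) auto
    qed
  qed
  have ZB: "Z \<subseteq> B" unfolding Z_def B_def using poincare_1_forms by blast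
  have Z0: "(\<lambda>x vs. 0) \<in> Z" by (simp add: Z_def fields_zero ext_deriv_def fun_eq_iff)
  have car: "{z \<in> carrier (foliated_forms Lambda0 1). foliated_deriv Lambda0 1 z = \<zero>\<^bsub>foliated_forms Lambda0 (Suc 1)\<^esub>} = ?s ` Z"
    by (auto simp: foliated_forms_singletons foliated_deriv_singleton Z_def)
  have N: "foliated_deriv Lambda0 0 ` carrier (foliated_forms Lambda0 0) = ?s ` B"
    by (simp add: foliated_forms_singletons foliated_deriv_singleton B_def image_image)
  have co: "(\<Union>h\<in>?s ` B. {h \<oplus>\<^bsub>foliated_forms Lambda0 1\<^esub> {z}}) = ?s ` B" if "z \<in> Z" for z
  proof -
    have "(\<Union>h\<in>?s ` B. {h \<oplus>\<^bsub>foliated_forms Lambda0 1\<^esub> {z}}) = ?s ` ((\<lambda>y x vs. y x vs + z x vs) ` B)"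
      by (auto simp: foliated_forms_singletons)
    also have "\<dots> = ?s ` B" using coset[of z] that ZB by (simp only: subsetD)
    finally show ?thesis .
  qed
  have "zero (foliated_cohomology Lambda0 1) = ?s ` B"
    using N by (simp add: foliated_cohomology_def cohomology_def quot_module_def)
  moreover have "carrier (foliated_cohomology Lambda0 1) = (\<Union>z\<in>Z. {?s ` B})"
    using N car co by (simp add: foliated_cohomology_def cohomology_def quot_module_def coset_defs)
  ultimately show ?thesis using Z0 by (metis UN_constant empty_iff)
qed

section \<open>Nambu-Poisson cohomology\<close>

text \<open>
  This is \<open>L\<^sub>X (i(u) \<nu>) = i([X, u] + (div X) u) \<nu>\<close>, with \<open>[X, u]\<close> the derivative of \<open>u\<close> along \<open>X\<close> minus that of
  \<open>X\<close> along \<open>u\<close>.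
\<close>
lemma lie_deriv_iota_nu:
  assumes X: "vsmooth X" and u: "vsmooth u"
  shows "lie_deriv X (iota_nu u) = iota_nu (\<lambda>x. jac u x (X x) - jac X x (u x) + divg X x *\<^sub>R u x)"
proof (intro ext)
  fix x vs
  show "lie_deriv X (iota_nu u) x vs = iota_nu (\<lambda>x. jac u x (X x) - jac X x (u x) + divg X x *\<^sub>R u x) x vs"
  proof (cases "length vs = 2")
    case False
    then show ?thesis by (simp add: lie_deriv_def iota_nu_def)
  next
    case True
    then obtain v w where vs: "vs = [v, w]" by (auto simp: length_Suc_conv numeral_2_eq_2)
    have tr: "det3 (jac X x (u x)) v w + det3 (u x) (jac X x v) w + det3 (u x) v (jac X x w) = divg X x * det3 (u x) v w"
      by (subst det3_trace[of "jac X x" "\<lambda>i. grad (\<lambda>z. X z $ i) x"]) (simp_all add: jac_def divg_def)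
    have "lie_deriv X (iota_nu u) x vs =
        jac u x (X x) \<bullet> (v \<times> w) + det3 (u x) (jac X x v) w + det3 (u x) v (jac X x w)"
      unfolding lie_deriv_def frechet_derivative_eq_jac[OF X] vs
      by (simp add: iota_nu_def lessThan_Suc frechet_derivative_inner_const[OF u] det3_def)
    also have "\<dots> = iota_nu (\<lambda>x. jac u x (X x) - jac X x (u x) + divg X x *\<^sub>R u x) x vs"
      using tr by (simp add: vs iota_nu_def det3_def inner_add_left inner_diff_left)
    finally show ?thesis .
  qed
qed

lemma sharp_3_ext_deriv_iota_nu:
  assumes u: "vsmooth u"
  shows "sharp Lambda0 3 (ext_deriv (iota_nu u)) x [] = sqn x * divg u x"
proof -
  have "ext_deriv (iota_nu u) x [pd 3, pd 1, pd 2] = divg u x"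
    by (simp add: ext_deriv_def remove_nth_def lessThan_Suc iota_nu_def frechet_derivative_inner_const[OF u])
       (simp add: inner3 cross3_nth pd_nth jac_nth divg_def)
  then show ?thesis
    unfolding sharp_def contract_3
    by (simp add: Lambda0_3 cov_dx det3_expand pd_nth)
qed

text \<open>The bracket of \<open>i(u) \<nu>\<close> and \<open>i(v) \<nu>\<close> is \<open>i(w) \<nu>\<close> with \<open>w = h [u, v] + (u h) v - (v h) u\<close>.\<close>
lemma form_bracket_iota_nu:
  assumes u: "vsmooth u" and v: "vsmooth v"
  shows "form_bracket Lambda0 (iota_nu u) (iota_nu v) =
    iota_nu (\<lambda>x. sqn x *\<^sub>R (jac v x (u x) - jac u x (v x)) + (grad sqn x \<bullet> u x) *\<^sub>R v x - (grad sqn x \<bullet> v x) *\<^sub>R u x)"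
proof (intro ext)
  fix x vs
  have X: "vec_of (sharp Lambda0 2 (iota_nu u)) = (\<lambda>x. sqn x *\<^sub>R u x)"
    by (simp add: fun_eq_iff vec_of_sharp_2 fields_alt[OF iota_nu_fields[OF u]] star2_iota_nu)
  have Xs: "vsmooth (\<lambda>x. sqn x *\<^sub>R u x)" by (intro vsmooth_scaleR u smooth_sqn)
  show "form_bracket Lambda0 (iota_nu u) (iota_nu v) x vs =
    iota_nu (\<lambda>x. sqn x *\<^sub>R (jac v x (u x) - jac u x (v x)) + (grad sqn x \<bullet> u x) *\<^sub>R v x - (grad sqn x \<bullet> v x) *\<^sub>R u x) x vs"
    unfolding form_bracket_def X lie_deriv_iota_nu[OF Xs v] sharp_3_ext_deriv_iota_nu[OF u]
    by (simp add: iota_nu_def jac_scaleR_right jac_scaleR u divg_scaleR inner_add_left inner_diff_left algebra_simps)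
qed

lemma ker_sharp2_Lambda0: "ker_sharp2 Lambda0 = {\<lambda>x vs. 0}"
proof -
  have z: "sharp Lambda0 2 (\<lambda>x vs. 0) = (\<lambda>x as. 0)" by (simp add: sharp_def contract_def fun_eq_iff)
  have "b = (\<lambda>x vs. 0)" if "b \<in> fields 2" "sharp Lambda0 2 b = (\<lambda>x as. 0)" for b
    using inj_onD[OF sharp_inj_on[of 2] _ that(1) fields_zero] that(2) z by simp
  then show ?thesis
    using z fields_zero by (auto simp: ker_sharp2_def a_kernel_def kernel_def field_module_def)
qed

text \<open>As the kernel of the sharp map is zero, a class consists of a single form.\<close>
lemma form_quot_singletons:
  "carrier (form_quot Lambda0) = (\<lambda>a. {a}) ` fields 2"
  "{a} \<oplus>\<^bsub>form_quot Lambda0\<^esub> {b} = {\<lambda>x vs. a x vs + b x vs}"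
  "f \<odot>\<^bsub>form_quot Lambda0\<^esub> {a} = {\<lambda>x vs. f x * a x vs}"
  by (simp_all only: form_quot_def ker_sharp2_Lambda0 quot_zero_singletons)

lemma diff_const: "diff (\<lambda>x. c) x = 0"
  by (rule blinfun_eqI) (simp add: blinfun_apply_diff)

lemma sharp_2_0: "sharp Lambda0 2 b x [0] = 0"
proof -
  have "cov 0 = 0" by (simp add: cov_def vec_eq_iff)
  then show ?thesis unfolding sharp_def contract_2 by (simp add: Lambda0_3 det3_expand)
qed

text \<open>
  The 1-cochain that sends the class of \<open>i(A) \<nu>\<close> to \<open>A h\<close>; off the origin it is the pullback of the
  1-form \<open>d(log h)\<close> along the sharp map.  The choice operator extracts the only element of a class.
\<close>
definition log_cochain :: cochain where
  "log_cochain As x =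
     (if length As = 1 \<and> set As \<subseteq> carrier (form_quot Lambda0)
      then grad sqn x \<bullet> star2 ((SOME b. b \<in> As ! 0) x) else 0)"

lemma log_cochain_singleton: "b \<in> fields 2 \<Longrightarrow> log_cochain [{b}] = (\<lambda>x. grad sqn x \<bullet> star2 (b x))"
  by (rule ext) (simp add: log_cochain_def form_quot_singletons)

lemma star2_add: "star2 (\<lambda>vs. a vs + b vs) = star2 a + star2 b"
  by (simp add: vec_eq_iff forall_3 star2_nth)

lemma star2_mult: "star2 (\<lambda>vs. c * a vs) = c *\<^sub>R star2 a"
  by (simp add: vec_eq_iff forall_3 star2_nth)

lemma log_cochain_cochain: "log_cochain \<in> np_cochains Lambda0 1"
  unfolding np_cochains_def Let_def
proof (intro CollectI conjI ballI allI impI)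
  fix As assume "As \<notin> {As. length As = 1 \<and> set As \<subseteq> carrier (form_quot Lambda0)}"
  then show "log_cochain As = (\<lambda>x. 0)" by (intro ext) (auto simp: log_cochain_def)
next
  fix As assume "As \<in> {As. length As = 1 \<and> set As \<subseteq> carrier (form_quot Lambda0)}"
  then obtain b where "As = [{b}]" "b \<in> fields 2" by (auto simp: length_Suc_conv form_quot_singletons)
  then show "smooth (log_cochain As)"
    by (simp add: log_cochain_singleton smooth_inner vsmooth_grad vsmooth_star2)
next
  fix As i A B x
  assume "As \<in> {As. length As = 1 \<and> set As \<subseteq> carrier (form_quot Lambda0)}" "i < (1::nat)"
    "A \<in> carrier (form_quot Lambda0)" "B \<in> carrier (form_quot Lambda0)"
  moreover from this obtain a b where "A = {a}" "a \<in> fields 2" "B = {b}" "b \<in> fields 2"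
    by (auto simp: form_quot_singletons)
  ultimately show "log_cochain (As[i := A \<oplus>\<^bsub>form_quot Lambda0\<^esub> B]) x = log_cochain (As[i := A]) x + log_cochain (As[i := B]) x"
    by (auto simp: length_Suc_conv form_quot_singletons log_cochain_singleton fields_add star2_add inner_add_right)
next
  fix As i A f x
  assume "As \<in> {As. length As = 1 \<and> set As \<subseteq> carrier (form_quot Lambda0)}" "i < (1::nat)"
    "A \<in> carrier (form_quot Lambda0)" "smooth f"
  moreover from this obtain a where "A = {a}" "a \<in> fields 2"
    by (auto simp: form_quot_singletons)
  ultimately show "log_cochain (As[i := f \<odot>\<^bsub>form_quot Lambda0\<^esub> A]) x = f x * log_cochain (As[i := A]) x"
    by (auto simp: length_Suc_conv form_quot_singletons log_cochain_singleton fields_mult star2_mult)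
qed auto

text \<open>
  With \<open>u\<close> and \<open>v\<close> the fields of the two forms, the coboundary is
  \<open>h u (v h) - h v (u h) - (h [u, v] + (u h) v - (v h) u) h = 0\<close>.
\<close>
lemma log_cochain_closed: "np_deriv Lambda0 1 log_cochain = (\<lambda>As x. 0)"
proof (intro ext)
  fix As x
  show "np_deriv Lambda0 1 log_cochain As x = 0"
  proof (cases "length As = 2 \<and> set As \<subseteq> carrier (form_quot Lambda0)")
    case False
    then show ?thesis by (auto simp: np_deriv_def)
  next
    case True
    then obtain a b where As: "As = [{a}, {b}]" and a: "a \<in> fields 2" and b: "b \<in> fields 2"
      by (auto simp: length_Suc_conv form_quot_singletons numeral_2_eq_2)
    define u v where "u = (\<lambda>x. star2 (a x))" and "v = (\<lambda>x. star2 (b x))"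
    have u: "vsmooth u" and v: "vsmooth v" unfolding u_def v_def by (intro vsmooth_star2 a b)+
    have au: "a = iota_nu u" and bv: "b = iota_nu v"
      unfolding u_def v_def by (intro fields_2_eq_iota_nu a b)+
    define w where "w = (\<lambda>x. sqn x *\<^sub>R (jac v x (u x) - jac u x (v x)) + (grad sqn x \<bullet> u x) *\<^sub>R v x - (grad sqn x \<bullet> v x) *\<^sub>R u x)"
    have br: "form_bracket Lambda0 a b = iota_nu w"
      unfolding au bv w_def by (rule form_bracket_iota_nu[OF u v])
    have "vsmooth w"
      unfolding w_def by (intro vsmooth_add vsmooth_diff vsmooth_scaleR smooth_sqn vsmooth_jac u v smooth_inner vsmooth_grad)
    then have c: "log_cochain [{iota_nu w}] x = grad sqn x \<bullet> w x"
      by (simp add: log_cochain_singleton iota_nu_fields star2_iota_nu)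
    \<comment> \<open>the field \<open>h p\<close> applied to the function \<open>q h\<close>\<close>
    have tm: "sharp Lambda0 2 (iota_nu p) x [diff (log_cochain [{iota_nu q}]) x] =
        sqn x * (jac (grad sqn) x (p x) \<bullet> q x + grad sqn x \<bullet> jac q x (p x))" if p: "vsmooth p" and q: "vsmooth q" for p q
    proof -
      have n: "log_cochain [{iota_nu q}] = (\<lambda>x. grad sqn x \<bullet> q x)"
        by (simp add: log_cochain_singleton iota_nu_fields q star2_iota_nu)
      have s: "smooth (\<lambda>x. grad sqn x \<bullet> q x)" by (intro smooth_inner vsmooth_grad q smooth_sqn)
      show ?thesis
        unfolding n
        by (simp add: sharp_2 fields_alt[OF iota_nu_fields[OF p]] star2_iota_nu cov_diff[OF s] inner_commute[of "p x"]
            grad_inner vsmooth_grad q)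
    qed
    have "np_deriv Lambda0 1 log_cochain As x =
        sharp Lambda0 2 a x [diff (log_cochain [{b}]) x] - sharp Lambda0 2 b x [diff (log_cochain [{a}]) x]
        - log_cochain [{form_bracket Lambda0 a b}] x"
    proof -
      have "{\<lambda>x vs. 0} +>\<^bsub>Omega 2\<^esub> w = {w}" for w :: form
        by (simp add: coset_defs field_module_def)
      then show ?thesis
        using True by (simp add: np_deriv_def As remove_nth_def ker_sharp2_Lambda0 atMost_Suc lessThan_Suc)
    qed
    also have "\<dots> = 0"
      unfolding br c unfolding au bv tm[OF u v] tm[OF v u]
      using jac_grad_symmetric[OF smooth_sqn, of x "u x" "v x"]
      by (simp add: w_def inner_add_right inner_diff_right algebra_simps)
    finally show ?thesis .
  qed
qed

text \<open>
  If it were the coboundary of a function \<open>f\<close>, its value on \<open>dx\<^sub>2 \<and> dx\<^sub>3\<close> would give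
  \<open>\<partial>\<^sub>1 h = h \<partial>\<^sub>1 f\<close>.
\<close>
lemma log_cochain_not_exact: "log_cochain \<notin> np_deriv Lambda0 0 ` np_cochains Lambda0 0"
proof
  assume "log_cochain \<in> np_deriv Lambda0 0 ` np_cochains Lambda0 0"
  then obtain c where c: "c \<in> np_cochains Lambda0 0" and eq: "log_cochain = np_deriv Lambda0 0 c" by blast
  have s: "smooth (c [])" using c by (auto simp: np_cochains_def Let_def)
  define b where "b = iota_nu (\<lambda>x. pd 1)"
  have b: "b \<in> fields 2" and st: "star2 (b x) = pd 1" for x
    unfolding b_def by (auto intro!: iota_nu_fields vsmooth_const simp: star2_iota_nu)
  show False
  proof (rule grad_sqn_not_multiple)
    show "smooth (\<lambda>x. grad (c []) x $ 1)" using s by (rule smooth_grad)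
    fix x
    have "log_cochain [{b}] x = np_deriv Lambda0 0 c [{b}] x" by (simp add: eq)
    also have "\<dots> = sharp Lambda0 2 b x [diff (c []) x]"
      using b by (simp add: np_deriv_def form_quot_singletons remove_nth_def)
    finally show "grad sqn x $ 1 = sqn x * grad (c []) x $ 1"
      by (simp add: log_cochain_singleton b st sharp_2 fields_alt[OF b] cov_diff[OF s] inner3 pd_nth)
  qed
qed

lemma np_deriv_zero: "np_deriv Lambda0 k (\<lambda>As x. 0) = (\<lambda>As x. 0)"
  by (simp add: np_deriv_def fun_eq_iff Let_def diff_const sharp_2_0)

lemma zero_np_cochain: "(\<lambda>As x. 0) \<in> np_cochains L k"
  by (simp add: np_cochains_def Let_def)

lemma np_cohomology_1_nontrivial:
  obtains X Y where "X \<in> carrier (np_cohomology Lambda0 1)" "Y \<in> carrier (np_cohomology Lambda0 1)" "X \<noteq> Y"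
proof -
  let ?N = "np_deriv Lambda0 0 ` np_cochains Lambda0 0"
  \<comment> \<open>the class of a cocycle\<close>
  let ?c = "\<lambda>z. (\<lambda>h As x. h As x + z As x) ` ?N"
  have "?c z \<in> carrier (np_cohomology Lambda0 1)"
    if "z \<in> np_cochains Lambda0 1" "np_deriv Lambda0 1 z = (\<lambda>As x. 0)" for z
    using that by (auto simp: np_cohomology_def cohomology_def quot_module_def coset_defs np_module_def)
  then have 1: "?c log_cochain \<in> carrier (np_cohomology Lambda0 1)" "?c (\<lambda>As x. 0) \<in> carrier (np_cohomology Lambda0 1)"
    using log_cochain_cochain log_cochain_closed zero_np_cochain np_deriv_zero by blast+
  have "(\<lambda>As x. 0) \<in> ?N" using zero_np_cochain np_deriv_zero by (metis image_eqI)
  then have "log_cochain \<in> ?c log_cochain" by (auto intro!: image_eqI)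
  moreover have "log_cochain \<notin> ?c (\<lambda>As x. 0)" using log_cochain_not_exact by auto
  ultimately have "?c log_cochain \<noteq> ?c (\<lambda>As x. 0)" by metis
  then show ?thesis using 1 that by blast
qed

lemma not_vs_isomorphic_np_foliated:
  "\<not> vs_isomorphic (np_cohomology Lambda0 1) (foliated_cohomology Lambda0 1)"
proof
  assume "vs_isomorphic (np_cohomology Lambda0 1) (foliated_cohomology Lambda0 1)"
  then obtain h where h: "bij_betw h (carrier (np_cohomology Lambda0 1)) (carrier (foliated_cohomology Lambda0 1))"
    by (auto simp: vs_isomorphic_def)
  obtain X Y where XY: "X \<in> carrier (np_cohomology Lambda0 1)" "Y \<in> carrier (np_cohomology Lambda0 1)" "X \<noteq> Y"
    by (rule np_cohomology_1_nontrivial)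
  have "h X = h Y"
    using bij_betwE[OF h] XY(1,2) unfolding foliated_cohomology_1_trivial by auto
  then show False
    using bij_betw_imp_inj_on[OF h] XY by (auto dest: inj_onD)
qed

section \<open>The structure as a counterexample\<close>

theorem mainTheorem9:
  shows "nambu_poisson Lambda0 \<and> (\<forall>as. Lambda0 0 as = 0) \<and>
    (\<forall>r\<in>{1,2,3}. sharp Lambda0 r \<in> mod_mono {f. smooth f} (Omega r) (Mvf (3 - r))) \<and>
    (\<forall>k. vs_isomorphic (foliated_cohomology Lambda0 k) (deRham k)) \<and>
    carrier (foliated_cohomology Lambda0 1) = {\<zero>\<^bsub>foliated_cohomology Lambda0 1\<^esub>} \<and>
    \<not> vs_isomorphic (np_cohomology Lambda0 1) (foliated_cohomology Lambda0 1) \<and>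
    \<not> (\<forall>k. vs_isomorphic (np_cohomology Lambda0 k) (foliated_cohomology Lambda0 k)) \<and>
    modular_bivector Lambda0 nu0 \<notin> sharp Lambda0 1 ` carrier (Omega 1) \<and>
    \<not> is_subcomplex nu0 (sharp_image Lambda0)"
proof (intro conjI allI ballI)
  show "Lambda0 0 as = 0" for as by (simp add: Lambda0_def)
  show "sharp Lambda0 r \<in> mod_mono {f. smooth f} (Omega r) (Mvf (3 - r))" if "r \<in> {1, 2, 3}" for r
    using that by (rule sharp_mod_mono)
  show "modular_bivector Lambda0 nu0 \<notin> sharp Lambda0 1 ` carrier (Omega 1)"
    using grad_bivector_not_sharp by (simp add: modular_bivector_eq field_module_def)
  show "\<not> (\<forall>k. vs_isomorphic (np_cohomology Lambda0 k) (foliated_cohomology Lambda0 k))"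
    using not_vs_isomorphic_np_foliated by blast
qed (fact nambu_poisson_Lambda0 foliated_iso_deRham foliated_cohomology_1_trivial
  not_vs_isomorphic_np_foliated not_subcomplex)+

end
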